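(* Fix $\varepsilon>0$, and let $p=p(n)\in[0,1]$ be any function of $n$ satisfying $\min(p,1-p)\geq (1+\varepsilon)\frac{\log n}{n}$ for all sufficiently large $n$. Let $M$ be a random $n\times n$ matrix whose entries are independent $\operatorname{Bernoulli}(p)$ random variables (each entry equals $1$ with probability $p$ and $0$ with probability $1-p$). Then \[\lim_{n\to\infty}\Pr(M\text{ is singular})=0.\]
   Context: Logarithms are to base $e$. Singularity of the zero-one matrix $M$ is meant over $\mathbb{R}$ (equivalently over $\mathbb{Q}$). *)

theory Defs
  imports "HOL-Probability.Probability" "Jordan_Normal_Form.Determinant"
begin

text \<open>
  The law of a random \<open>n \<times> n\<close> real matrix with independent Bernoulli \<open>q\<close> entries.
  Outside \<open>{..<n} \<times> {..<n}\<close> the product distribution takes the default value \<open>False\<close>,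
  which the matrix does not see. Note that \<^const>\<open>bernoulli_pmf\<close> clips its parameter to
  the unit interval, so \<open>q\<close> is the success probability only if \<open>0 \<le> q \<le> 1\<close>.
\<close>

definition bernoulli_mat_pmf :: "nat \<Rightarrow> real \<Rightarrow> real mat pmf" where
  "bernoulli_mat_pmf n q =
     map_pmf (\<lambda>X. mat n n (\<lambda>ij. of_bool (X ij)))
       (Pi_pmf ({..<n} \<times> {..<n}) False (\<lambda>_. bernoulli_pmf q))"

definition singular_mat :: "'a :: semiring_1 mat \<Rightarrow> bool" where
  "singular_mat A \<longleftrightarrow> square_mat A \<and> \<not> invertible_mat A"

end

theory Submission
  imports Defs "HOL-Real_Asymp.Real_Asymp"
begin

text \<open>
  Passing from \<open>p\<close> to \<open>q = min p (1 - p)\<close>, the entries are \<open>e (X i j)\<close> with independent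
  Bernoulli \<open>q\<close> bits \<open>X i j\<close> and an injective \<open>e :: bool \<Rightarrow> real\<close>. Fix small constants
  \<open>c\<close> and \<open>\<delta>\<close>.
  A nonzero kernel vector with support \<open>S\<close> and \<open>|S| q < c\<close> cannot exist if one row has no
  \<open>True\<close> bit in \<open>S\<close> and another has exactly one; a union bound over \<open>S\<close> gives such rows,
  and it is here that the constant \<open>1 + \<epsilon>\<close> is needed.
  For supports with \<open>c / q \<le> |S| \<le> \<delta> n\<close>, at most \<open>|S|\<close> rows determine the kernel of the
  columns \<open>S\<close>, and a vector chosen from these rows alone is orthogonal to each remaining row
  with probability at most \<open>1 - c / 4\<close>; this beats the number of choices of \<open>S\<close> and of the rows.
  Hence all left and right kernel vectors have support larger than \<open>\<delta> n\<close>. If the matrix is singular,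
  then for every \<open>i\<close> in the support of a left kernel vector, row \<open>i\<close> is orthogonal to a
  vector chosen from the other rows, whose support is also larger than \<open>\<delta> n\<close>. By a biased
  Littlewood-Offord inequality this has probability \<open>O((\<delta> n q) powr (-1/2))\<close> for each \<open>i\<close>, and averaging over
  \<open>i\<close> concludes.
\<close>

subsection \<open>A biased Littlewood-Offord inequality\<close>


text \<open>With \<open>V = s q (1 - q)\<close>, the ratio of consecutive terms at distance \<open>j\<close> above the mode is at
  least \<open>1 - (j + 1) / V\<close>, so about \<open>sqrt (V / 2)\<close> terms are at least half the maximum.\<close>

lemma binomial_term_le:
  fixes q :: real
  assumes q: "0 < q" "q < 1"
  shows "real (s choose k) * q ^ k * (1 - q) ^ (s - k) * sqrt (real s * q * (1 - q) / 2) \<le> 2"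
proof (cases "s = 0")
  case True
  then show ?thesis by simp
next
  case False
  define b where "b k = real (s choose k) * q ^ k * (1 - q) ^ (s - k)" for k
  define V where "V = real s * q * (1 - q)"
  have V: "V > 0" using False q by (simp add: V_def)
  have b0: "b k \<ge> 0" for k using q by (simp add: b_def)
  \<comment> \<open>The ratio of consecutive terms, cross-multiplied so that it also holds for
    \<open>k \<ge> s\<close>, where both sides are 0.\<close>
  have step: "b (Suc k) * (real (Suc k) * (1 - q)) = b k * ((real s - real k) * q)" for k
  proof (cases "k < s")
    case True
    then have "Suc k * (s choose Suc k) = (s - k) * (s choose k)"
      by (metis binomial_absorb_comp binomial_absorption mult.commute)
    then have "real (Suc k) * real (s choose Suc k) = (real s - real k) * real (s choose k)"
      using True by (metis less_imp_le_nat of_nat_diff of_nat_mult)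
    moreover have "(1 - q) ^ (s - k) = (1 - q) * (1 - q) ^ (s - Suc k)"
      using True by (metis Suc_diff_Suc power_Suc)
    moreover have "b (Suc k) * (real (Suc k) * (1 - q)) =
        (real (Suc k) * real (s choose Suc k)) * q ^ Suc k * ((1 - q) * (1 - q) ^ (s - Suc k))"
      unfolding b_def by (simp only: mult_ac)
    moreover have "\<dots> = ((real s - real k) * real (s choose k)) * q ^ Suc k * (1 - q) ^ (s - k)"
      using calculation by simp
    moreover have "\<dots> = b k * ((real s - real k) * q)"
      unfolding b_def by (simp add: mult_ac)
    ultimately show ?thesis by argo
  next
    case False
    then show ?thesis by (cases "k = s") (auto simp: b_def binomial_eq_0)
  qed
  have binom_sum: "(\<Sum>k\<le>s. b k) = 1"
    using binomial_ring[of q "1 - q" s] by (simp add: b_def)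
  obtain m where m: "m \<le> s" and max: "\<And>k. b k \<le> b m"
  proof -
    have "Max (b ` {..s}) \<in> b ` {..s}" by (rule Max_in) auto
    then obtain m where m: "m \<le> s" "Max (b ` {..s}) = b m" by (metis atMost_iff imageE)
    moreover have "b k \<le> b m" for k
    proof (cases "k \<le> s")
      case True
      then have "b k \<le> Max (b ` {..s})" by simp
      then show ?thesis using m by simp
    next
      case False
      then show ?thesis using b0[of m] by (simp add: b_def binomial_eq_0)
    qed
    ultimately show ?thesis using that by blast
  qed
  have bm: "b m > 0"
    using max[of 0] q by (auto simp: b_def intro: less_le_trans[rotated])
  have mode: "(real s - real m) * q \<le> real (Suc m) * (1 - q)"
  proof -
    have "b m * ((real s - real m) * q) \<le> b m * (real (Suc m) * (1 - q))"
      unfolding step[symmetric] using max[of "Suc m"] q by (intro mult_right_mono) auto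
    then show ?thesis using bm by simp
  qed
  \<comment> \<open>The quotient of the two terms is \<open>(s - m - j) q / D\<close>. Comparing
    \<open>b m\<close> with the next term (\<open>mode\<close>) gives \<open>D \<ge> V\<close>;
    comparing it with the previous term gives \<open>s q \<ge> m - q\<close>, so the numerator falls
    short of \<open>D\<close> by at most \<open>j + 1\<close>.\<close>
  have ratio: "b (m + Suc j) \<ge> b (m + j) * (1 - real (Suc j) / V)" for j
  proof -
    define D where "D = real (Suc (m + j)) * (1 - q)"
    have D: "D > 0" using q by (simp add: D_def)
    have D2: "D \<ge> V"
    proof -
      have "real s * q \<le> real (Suc m) - q" using mode by (simp add: algebra_simps)
      then have "real s * q \<le> real (Suc (m + j))" using q by simp
      then show ?thesis unfolding D_def V_def using q by (intro mult_right_mono) auto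
    qed
    have "D - (real s - real (m + j)) * q \<le> real (Suc j)"
      using mode q unfolding D_def
    proof -
      have "real s * q \<ge> real m - q"
      proof (cases m)
        case 0
        have "0 \<le> real s * q" using q by simp
        then show ?thesis using q unfolding 0 by linarith
      next
        case (Suc i)
        have "b m * ((real s - real i) * q) \<ge> b m * (real m * (1 - q))"
        proof -
          have "b m * (real m * (1 - q)) = b i * ((real s - real i) * q)"
            using step[of i] Suc by simp
          also have "\<dots> \<le> b m * ((real s - real i) * q)"
            using max[of i] q m Suc by (intro mult_right_mono) auto
          finally show ?thesis .
        qed
        then have "real m * (1 - q) \<le> (real s - real i) * q" using bm by simp
        then show ?thesis using Suc by (simp add: algebra_simps)
      qed
      then show "real (Suc (m + j)) * (1 - q) - (real s - real (m + j)) * q \<le> real (Suc j)"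
        using q by (simp add: algebra_simps)
    qed
    then have "D * (1 - real (Suc j) / D) \<le> (real s - real (m + j)) * q"
      using D by (simp add: right_diff_distrib)
    then have "b (m + j) * (D * (1 - real (Suc j) / D)) \<le> b (m + Suc j) * D"
      using step[of "m + j"] b0[of "m + j"] unfolding D_def[symmetric]
      by (metis add_Suc_right mult_left_mono)
    then have "b (m + j) * (1 - real (Suc j) / D) \<le> b (m + Suc j)"
      using D by (simp add: mult.assoc[symmetric] mult.commute[of D])
    moreover have "1 - real (Suc j) / V \<le> 1 - real (Suc j) / D"
      using D2 V by (simp add: frac_le)
    ultimately show ?thesis
      using mult_left_mono[OF _ b0[of "m + j"]] order_trans by blast
  qed
  \<comment> \<open>With this \<open>L\<close> the loss \<open>j^2 / V\<close> in
    \<open>near\<close> is at most 1/2 for all \<open>j \<le> L\<close>.\<close>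
  define L where "L = nat \<lfloor>sqrt (V / 2)\<rfloor>"
  have L: "real L \<le> sqrt (V / 2)" and L1: "sqrt (V / 2) \<le> real L + 1"
    unfolding L_def using V by (simp_all add: real_nat_ceiling_ge less_imp_le)
  have LV: "(real L)\<^sup>2 \<le> V / 2"
    using L V by (metis abs_of_nonneg half_gt_zero less_imp_le of_nat_0_le_iff real_sqrt_abs real_sqrt_le_iff)
  \<comment> \<open>Multiplying the ratios loses at most \<open>(1 + ... + j) / V\<close>, and
    \<open>1 + ... + j \<le> j^2\<close>. The restriction to \<open>j \<le> L\<close> keeps every
    factor nonnegative.\<close>
  have near: "b (m + j) \<ge> b m * (1 - (real j)\<^sup>2 / V)" if "j \<le> L" for j
    using that
  proof (induction j)
    case (Suc j)
    have "real (Suc j) \<le> (real (Suc j))\<^sup>2" by (simp add: power2_eq_square)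
    also have "\<dots> \<le> (real L)\<^sup>2" using Suc.prems by (intro power_mono) auto
    also have "\<dots> \<le> V" using LV V by simp
    finally have le: "1 - real (Suc j) / V \<ge> 0" using V by simp
    have "1 - (real (Suc j))\<^sup>2 / V \<le> 1 - (real j)\<^sup>2 / V - real (Suc j) / V"
      using V by (simp add: field_simps power2_eq_square)
    also have "\<dots> \<le> (1 - (real j)\<^sup>2 / V) * (1 - real (Suc j) / V)"
    proof -
      have "(1 - u) * (1 - v) = 1 - u - v + u * v" for u v :: real by (simp add: algebra_simps)
      then show ?thesis using V by simp
    qed
    finally have "b m * (1 - (real (Suc j))\<^sup>2 / V) \<le> b m * (1 - (real j)\<^sup>2 / V) * (1 - real (Suc j) / V)"
      using bm by (simp add: mult.assoc)
    also have "\<dots> \<le> b (m + j) * (1 - real (Suc j) / V)"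
      using Suc le by (intro mult_right_mono) auto
    also have "\<dots> \<le> b (m + Suc j)" by (rule ratio)
    finally show ?case .
  qed simp
  have half: "b (m + j) \<ge> b m / 2" if "j \<le> L" for j
  proof -
    have "(real j)\<^sup>2 / V \<le> (real L)\<^sup>2 / V" using that V by (intro divide_right_mono power_mono) auto
    also have "\<dots> \<le> 1 / 2" using LV V by (simp add: field_simps)
    finally have "b m * (1 / 2) \<le> b m * (1 - (real j)\<^sup>2 / V)" using bm by (intro mult_left_mono) auto
    then show ?thesis using near[OF that] by linarith
  qed
  have "(real L + 1) * (b m / 2) = (\<Sum>j\<le>L. b m / 2)" by simp
  also have "\<dots> \<le> (\<Sum>j\<le>L. b (m + j))" by (intro sum_mono) (use half in auto)
  also have "\<dots> = (\<Sum>k\<in>{m..m + L}. b k)"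
    by (rule sum.reindex_bij_witness[of _ "\<lambda>k. k - m" "\<lambda>j. m + j"]) auto
  \<comment> \<open>The window above the mode may run past \<open>s\<close>, where the terms
    vanish.\<close>
  also have "\<dots> = (\<Sum>k\<in>{m..m + L} \<inter> {..s}. b k)"
    by (intro sum.mono_neutral_right) (auto simp: b_def)
  also have "\<dots> \<le> (\<Sum>k\<le>s. b k)" by (intro sum_mono2) (auto simp: b0)
  finally have "(real L + 1) * b m \<le> 2" using binom_sum by simp
  moreover have "b k * sqrt (V / 2) \<le> b m * (real L + 1)"
    using max[of k] L1 b0 V by (intro mult_mono) auto
  ultimately show ?thesis unfolding b_def V_def by (simp add: mult.commute)
qed

text \<open>A form of the LYM inequality for the antichain of subsets of prescribed weight. For
  \<open>A \<noteq> S\<close> the summand is spread over the elements of \<open>S - A\<close>, which gives an induction.\<close>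

lemma sum_fact_weight_le:
  fixes w :: "'a \<Rightarrow> real"
  assumes "finite S" "\<And>i. i \<in> S \<Longrightarrow> w i > 0"
  shows "(\<Sum>A | A \<subseteq> S \<and> sum w A = a. fact (card A) * fact (card S - card A) :: real) \<le> fact (card S)"
  using assms
proof (induction "card S" arbitrary: S)
  case 0
  then have "{A. A \<subseteq> S \<and> sum w A = a} = (if a = 0 then {{}} else {})" by auto
  then show ?case using "0.hyps" by simp
next
  case (Suc s)
  let ?F = "\<lambda>S. {A. A \<subseteq> S \<and> sum w A = a}"
  let ?f = "\<lambda>S A. fact (card A) * fact (card S - card A) :: real"
  have fin: "finite (?F T)" if "T \<subseteq> S" for T
    using that Suc.prems(1) by (auto intro: finite_subset[of _ "Pow S"])
  show ?case
  proof (cases "sum w S = a")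
    \<comment> \<open>By positivity of the weights every proper subset of \<open>S\<close> weighs
      less than \<open>S\<close>, so \<open>S\<close> is the only summand.\<close>
    case True
    have "A = S" if "A \<subseteq> S" "sum w A = a" for A
    proof (rule ccontr)
      assume "A \<noteq> S"
      then have "S - A \<noteq> {}" using that by blast
      then obtain b where "b \<in> S - A" by blast
      then have "sum w A < sum w S"
        using that Suc.prems by (intro sum_strict_mono2[of S A b]) (auto intro: less_imp_le)
      then show False using that True by simp
    qed
    then have "?F S = {S}" using True by auto
    then show ?thesis by simp
  next
    case False
    have "(\<Sum>A\<in>?F S. ?f S A) = (\<Sum>A\<in>?F S. \<Sum>i\<in>S - A. ?f (S - {i}) A)"
    proof (rule sum.cong[OF refl])
      fix A assume A: "A \<in> ?F S"
      then have fA: "finite A" and less: "card A < card S"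
        using False Suc.prems(1) finite_subset psubset_card_mono[of S A] by auto
      have "(\<Sum>i\<in>S - A. ?f (S - {i}) A) = (\<Sum>i\<in>S - A. fact (card A) * fact (card S - 1 - card A))"
        using Suc.prems(1) by (intro sum.cong) auto
      also have "\<dots> = real (card S - card A) * (fact (card A) * fact (card S - 1 - card A))"
        using A fA by (simp add: card_Diff_subset)
      also have "\<dots> = ?f S A"
        using less fact_reduce[of "card S - card A", where 'a=real] by (simp add: mult.left_commute)
      finally show "?f S A = (\<Sum>i\<in>S - A. ?f (S - {i}) A)" by simp
    qed
    also have "\<dots> = (\<Sum>(A, i)\<in>(SIGMA A:?F S. S - A). ?f (S - {i}) A)"
      using fin Suc.prems(1) by (intro sum.Sigma) auto
    also have "\<dots> = (\<Sum>(i, A)\<in>(SIGMA i:S. ?F (S - {i})). ?f (S - {i}) A)"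
      by (rule sum.reindex_bij_witness[of _ "\<lambda>(i, A). (A, i)" "\<lambda>(A, i). (i, A)"]) auto
    also have "\<dots> = (\<Sum>i\<in>S. \<Sum>A\<in>?F (S - {i}). ?f (S - {i}) A)"
      using fin Suc.prems(1) by (intro sum.Sigma[symmetric]) auto
    also have "\<dots> \<le> (\<Sum>i\<in>S. fact s)"
    proof (rule sum_mono)
      fix i assume "i \<in> S"
      then have "card (S - {i}) = s" using Suc by simp
      then show "(\<Sum>A\<in>?F (S - {i}). ?f (S - {i}) A) \<le> fact s"
        using Suc.hyps(1)[of "S - {i}"] Suc.prems by auto
    qed
    also have "\<dots> = fact (card S)" using Suc.hyps(2)[symmetric] by simp
    finally show ?thesis .
  qed
qed


text \<open>Fubini, revealing the coordinates in \<open>A\<close> first: given \<open>Y\<close>, the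
  event \<open>E\<close> has conditional probability at most \<open>\<beta>\<close>, and probability
  0 when \<open>F Y\<close> fails.\<close>

lemma prob_Pi_pmf_union_le_mult:
  assumes "finite A" "finite B" "A \<inter> B = {}" "\<beta> \<ge> 0"
    and le: "\<And>Y. measure_pmf.prob (Pi_pmf B d p) {Z. E (\<lambda>x. if x \<in> A then Y x else Z x)}
      \<le> (if F Y then \<beta> else 0)"
  shows "measure_pmf.prob (Pi_pmf (A \<union> B) d p) {X. E X} \<le> measure_pmf.prob (Pi_pmf A d p) {Y. F Y} * \<beta>"
proof -
  let ?m = "\<lambda>Y Z x. if x \<in> A then Y x else Z x"
  have "emeasure (Pi_pmf (A \<union> B) d p) {X. E X} =
      emeasure (bind_pmf (Pi_pmf A d p) (\<lambda>Y. map_pmf (?m Y) (Pi_pmf B d p))) {X. E X}"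
    using assms by (simp add: Pi_pmf_union pair_pmf_def map_pmf_def bind_assoc_pmf bind_return_pmf)
  also have "\<dots> = (\<integral>\<^sup>+Y. emeasure (Pi_pmf B d p) {Z. E (?m Y Z)} \<partial>Pi_pmf A d p)"
    by (simp add: vimage_def)
  also have "\<dots> \<le> (\<integral>\<^sup>+Y. ennreal \<beta> * indicator {Y. F Y} Y \<partial>Pi_pmf A d p)"
  proof (rule nn_integral_mono)
    fix Y
    show "emeasure (Pi_pmf B d p) {Z. E (?m Y Z)} \<le> ennreal \<beta> * indicator {Y. F Y} Y"
      using le[of Y] \<open>\<beta> \<ge> 0\<close>
      by (auto simp: measure_pmf.emeasure_eq_measure ennreal_leI indicator_def measure_le_0_iff split: if_splits)
  qed
  also have "\<dots> = ennreal (\<beta> * measure_pmf.prob (Pi_pmf A d p) {Y. F Y})"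
    using \<open>\<beta> \<ge> 0\<close> by (simp add: nn_integral_cmult_indicator measure_pmf.emeasure_eq_measure ennreal_mult)
  finally show ?thesis
    using \<open>\<beta> \<ge> 0\<close> by (simp add: measure_pmf.emeasure_eq_measure mult.commute)
qed

lemma prob_Pi_pmf_union_le:
  assumes "finite A" "finite B" "A \<inter> B = {}"
    and le: "\<And>Y. measure_pmf.prob (Pi_pmf B d p) {Z. E (\<lambda>x. if x \<in> A then Y x else Z x)} \<le> \<beta>"
  shows "measure_pmf.prob (Pi_pmf (A \<union> B) d p) {X. E X} \<le> \<beta>"
  using prob_Pi_pmf_union_le_mult[OF assms(1-3), of \<beta> d p E "\<lambda>_. True"] le
    order_trans[OF measure_nonneg le] by simp


section \<open>Anti-concentration of linear forms in independent bits\<close>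

abbreviation bernoulli_family :: "'a set \<Rightarrow> real \<Rightarrow> ('a \<Rightarrow> bool) pmf" where
  "bernoulli_family T q \<equiv> Pi_pmf T False (\<lambda>_. bernoulli_pmf q)"

lemma prob_card_True_eq:
  assumes "finite T" "S \<subseteq> T" "q \<in> {0..1}"
  shows "measure_pmf.prob (bernoulli_family T q) {X. card {j \<in> S. X j} = k} =
    real (card S choose k) * q ^ k * (1 - q) ^ (card S - k)"
proof -
  have "finite S" using assms finite_subset by blast
  have "measure_pmf.prob (bernoulli_family T q) {X. card {j \<in> S. X j} = k} =
      measure_pmf.prob (map_pmf (\<lambda>X. card {j \<in> S. X j}) (bernoulli_family S q)) {k}"
    using assms by (simp add: Pi_pmf_subset[of T S] vimage_def conj_commute cong: conj_cong)
  also have "map_pmf (\<lambda>X. card {j \<in> S. X j}) (bernoulli_family S q) = binomial_pmf (card S) q"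
    using binomial_pmf_altdef'[OF \<open>finite S\<close> refl assms(3)] by simp
  finally show ?thesis using assms by (simp add: measure_pmf_single)
qed

text \<open>A set \<open>A\<close> of True bits has probability
  \<open>q ^ card A * (1 - q) ^ (card S - card A)\<close>, which \<open>binomial_term_le\<close>
  bounds by a multiple of one over the binomial coefficient; \<open>sum_fact_weight_le\<close> says
  that these reciprocals sum to at most 1. The product form stays correct for empty
  \<open>S\<close>, where dividing by the root would give the bound 0.\<close>

lemma prob_weighted_sum_le:
  fixes w :: "'a \<Rightarrow> real"
  assumes S: "finite S" and w: "\<And>j. j \<in> S \<Longrightarrow> w j > 0" and q: "0 < q" "q < 1"
  shows "measure_pmf.prob (bernoulli_family S q) {X. (\<Sum>j\<in>S. of_bool (X j) * w j) = a}
    * sqrt (real (card S) * q * (1 - q) / 2) \<le> 2"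
proof -
  let ?P = "bernoulli_family S q" and ?F = "{A. A \<subseteq> S \<and> sum w A = a}"
  let ?i = "\<lambda>A (j::'a). j \<in> A"
  define R where "R = sqrt (real (card S) * q * (1 - q) / 2)"
  have R: "R \<ge> 0" using q by (simp add: R_def)
  have fin: "finite ?F" using S by (auto intro: finite_subset[of _ "Pow S"])
  have "{X. (\<Sum>j\<in>S. of_bool (X j) * w j) = a} \<inter> set_pmf ?P = (?i ` ?F) \<inter> set_pmf ?P"
  proof (intro equalityI subsetI)
    fix X assume X: "X \<in> {X. (\<Sum>j\<in>S. of_bool (X j) * w j) = a} \<inter> set_pmf ?P"
    then have sub: "Collect X \<subseteq> S" using set_Pi_pmf_subset[OF S] by fastforce
    have "sum w (Collect X) = (\<Sum>j\<in>S. of_bool (X j) * w j)"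
      using S sub by (intro sum.mono_neutral_cong_left) auto
    then have "Collect X \<in> ?F" using X sub by simp
    moreover have "X = ?i (Collect X)" by auto
    ultimately show "X \<in> (?i ` ?F) \<inter> set_pmf ?P" using X by blast
  next
    fix X assume X: "X \<in> (?i ` ?F) \<inter> set_pmf ?P"
    then obtain A where A: "A \<subseteq> S" "sum w A = a" "X = ?i A" by auto
    have "(\<Sum>j\<in>S. of_bool (X j) * w j) = sum w A"
      using S A by (intro sum.mono_neutral_cong_right) auto
    then show "X \<in> {X. (\<Sum>j\<in>S. of_bool (X j) * w j) = a} \<inter> set_pmf ?P" using A X by simp
  qed
  from arg_cong[OF this, of "measure_pmf.prob ?P"]
  have "measure_pmf.prob ?P {X. (\<Sum>j\<in>S. of_bool (X j) * w j) = a} = measure_pmf.prob ?P (?i ` ?F)"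
    by (simp only: measure_Int_set_pmf)
  also have "\<dots> = (\<Sum>A\<in>?F. pmf ?P (?i A))"
    unfolding measure_measure_pmf_finite[OF finite_imageI[OF fin]]
    by (subst sum.reindex) (auto simp: inj_on_def fun_eq_iff)
  also have "\<dots> = (\<Sum>A\<in>?F. q ^ card A * (1 - q) ^ (card S - card A))"
  proof (rule sum.cong[OF refl])
    fix A assume "A \<in> ?F"
    then have A: "A \<subseteq> S" "finite A" using S finite_subset by auto
    have "pmf ?P (?i A) = (\<Prod>j\<in>S. if j \<in> A then q else 1 - q)"
      using S A q by (subst pmf_Pi') (auto intro!: prod.cong)
    also have "\<dots> = (\<Prod>j\<in>A. if j \<in> A then q else 1 - q) * (\<Prod>j\<in>S - A. if j \<in> A then q else 1 - q)"
      using A S by (metis mult.commute prod.subset_diff)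
    also have "\<dots> = q ^ card A * (1 - q) ^ (card S - card A)"
      using A by (simp add: card_Diff_subset)
    finally show "pmf ?P (?i A) = q ^ card A * (1 - q) ^ (card S - card A)" .
  qed
  finally have "measure_pmf.prob ?P {X. (\<Sum>j\<in>S. of_bool (X j) * w j) = a} * R =
      (\<Sum>A\<in>?F. q ^ card A * (1 - q) ^ (card S - card A) * R)"
    by (simp add: sum_distrib_right)
  also have "\<dots> \<le> (\<Sum>A\<in>?F. 2 / fact (card S) * (fact (card A) * fact (card S - card A)))"
  proof (rule sum_mono)
    fix A assume "A \<in> ?F"
    then have le: "card A \<le> card S" using S card_mono by auto
    have "real (card S choose card A) * q ^ card A * (1 - q) ^ (card S - card A) * R \<le> 2"
      unfolding R_def by (rule binomial_term_le[OF q])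
    then show "q ^ card A * (1 - q) ^ (card S - card A) * R
        \<le> 2 / fact (card S) * (fact (card A) * fact (card S - card A))"
      unfolding binomial_fact[OF le, where 'a=real] by (simp add: field_simps)
  qed
  also have "\<dots> = 2 / fact (card S) * (\<Sum>A\<in>?F. fact (card A) * fact (card S - card A))"
    by (simp add: sum_distrib_left)
  also have "\<dots> \<le> 2 / fact (card S) * fact (card S)"
    using S w by (intro mult_left_mono sum_fact_weight_le) auto
  finally show ?thesis unfolding R_def by simp
qed

text \<open>Fixing the coordinates outside \<open>S\<close> only shifts the target value, which is
  why the hypothesis is uniform in \<open>a\<close>.\<close>

lemma prob_sum_eq_le_subset:
  fixes f :: "'a \<Rightarrow> 'b \<Rightarrow> 'c :: ab_group_add"
  assumes "finite T" "S \<subseteq> T"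
    and le: "\<And>a. measure_pmf.prob (Pi_pmf S d p) {X. (\<Sum>j\<in>S. f j (X j)) = a} \<le> \<beta>"
  shows "measure_pmf.prob (Pi_pmf T d p) {X. (\<Sum>j\<in>T. f j (X j)) = a} \<le> \<beta>"
proof -
  have fin: "finite S" using assms finite_subset by blast
  have "measure_pmf.prob (Pi_pmf ((T - S) \<union> S) d p) {X. (\<Sum>j\<in>T. f j (X j)) = a} \<le> \<beta>"
  proof (rule prob_Pi_pmf_union_le)
    fix Y :: "'a \<Rightarrow> 'b"
    have "(\<Sum>j\<in>T. f j (if j \<in> T - S then Y j else Z j)) =
        (\<Sum>j\<in>T - S. f j (Y j)) + (\<Sum>j\<in>S. f j (Z j))" for Z
      using assms(1,2) by (subst sum.subset_diff[of S T]) (auto intro!: arg_cong2[of _ _ _ _ "(+)"] sum.cong)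
    then have "{Z. (\<Sum>j\<in>T. f j (if j \<in> T - S then Y j else Z j)) = a} =
        {Z. (\<Sum>j\<in>S. f j (Z j)) = a - (\<Sum>j\<in>T - S. f j (Y j))}"
      by (auto simp: algebra_simps)
    then show "measure_pmf.prob (Pi_pmf S d p)
        {Z. (\<Sum>j\<in>T. f j (if j \<in> T - S then Y j else Z j)) = a} \<le> \<beta>"
      using le by simp
  qed (use assms fin in auto)
  moreover have "T - S \<union> S = T" using assms by auto
  ultimately show ?thesis by simp
qed

text \<open>The form is affine in the bits with slopes \<open>w j\<close>. At least half of the
  nonzero slopes share a sign \<open>\<sigma>\<close>, and \<open>prob_weighted_sum_le\<close>
  applies to these after multiplication by \<open>\<sigma>\<close>; the halving turns its 2 under
  the root into 4.\<close>

lemma prob_linear_form_le: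
  fixes x :: "'a \<Rightarrow> real" and e :: "bool \<Rightarrow> real"
  assumes T: "finite T" and e: "e True \<noteq> e False" and q: "0 < q" "q < 1"
  shows "measure_pmf.prob (bernoulli_family T q) {X. (\<Sum>j\<in>T. e (X j) * x j) = a}
    * sqrt (real (card {j \<in> T. x j \<noteq> 0}) * q * (1 - q) / 4) \<le> 2"
proof -
  define w where "w j = (e True - e False) * x j" for j
  define S where "S \<sigma> = {j \<in> T. \<sigma> * w j > 0}" for \<sigma> :: real
  have fin: "finite (S \<sigma>)" for \<sigma> using T by (simp add: S_def)
  have one: "measure_pmf.prob (bernoulli_family T q) {X. (\<Sum>j\<in>T. e (X j) * x j) = a}
      * sqrt (real (card (S \<sigma>)) * q * (1 - q) / 2) \<le> 2" if \<sigma>: "\<sigma> \<noteq> 0" for \<sigma>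
  proof (cases "S \<sigma> = {}")
    case False
    define r where "r = sqrt (real (card (S \<sigma>)) * q * (1 - q) / 2)"
    have r: "r > 0" using False fin[of \<sigma>] q by (simp add: r_def card_gt_0_iff)
    have "measure_pmf.prob (bernoulli_family T q) {X. (\<Sum>j\<in>T. e (X j) * x j) = a} \<le> 2 / r"
    proof (rule prob_sum_eq_le_subset[OF T])
      fix a
      have eq: "of_bool b * (\<sigma> * w j) = \<sigma> * (e b * x j) - \<sigma> * (e False * x j)" for b j
        by (cases b) (auto simp: w_def algebra_simps)
      have "(\<Sum>j\<in>S \<sigma>. of_bool (X j) * (\<sigma> * w j)) =
          \<sigma> * ((\<Sum>j\<in>S \<sigma>. e (X j) * x j) - (\<Sum>j\<in>S \<sigma>. e False * x j))" for X
        unfolding eq by (simp only: sum_subtractf sum_distrib_left right_diff_distrib)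
      then have "{X. (\<Sum>j\<in>S \<sigma>. e (X j) * x j) = a} \<subseteq>
          {X. (\<Sum>j\<in>S \<sigma>. of_bool (X j) * (\<sigma> * w j)) = \<sigma> * (a - (\<Sum>j\<in>S \<sigma>. e False * x j))}"
        by auto
      then have "measure_pmf.prob (bernoulli_family (S \<sigma>) q) {X. (\<Sum>j\<in>S \<sigma>. e (X j) * x j) = a} \<le>
          measure_pmf.prob (bernoulli_family (S \<sigma>) q)
          {X. (\<Sum>j\<in>S \<sigma>. of_bool (X j) * (\<sigma> * w j)) = \<sigma> * (a - (\<Sum>j\<in>S \<sigma>. e False * x j))}"
        by (intro measure_pmf.finite_measure_mono) auto
      also have "\<dots> \<le> 2 / r"
        unfolding pos_le_divide_eq[OF r] unfolding r_def
        by (rule prob_weighted_sum_le[OF fin _ q]) (simp add: S_def)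
      finally show "measure_pmf.prob (bernoulli_family (S \<sigma>) q) {X. (\<Sum>j\<in>S \<sigma>. e (X j) * x j) = a} \<le> 2 / r" .
    qed (auto simp: S_def)
    then show ?thesis unfolding pos_le_divide_eq[OF r] unfolding r_def .
  qed simp
  have "{j \<in> T. x j \<noteq> 0} = S 1 \<union> S (-1)" "S 1 \<inter> S (-1) = {}"
    using e by (auto simp: S_def w_def zero_less_mult_iff mult_less_0_iff)
  then have "card {j \<in> T. x j \<noteq> 0} = card (S 1) + card (S (-1))"
    using fin by (simp add: card_Un_disjoint)
  then obtain \<sigma> where \<sigma>: "\<sigma> \<noteq> 0" "real (card {j \<in> T. x j \<noteq> 0}) \<le> 2 * real (card (S \<sigma>))"
    by (cases "card (S 1) \<ge> card (S (-1))") (use that[of 1] that[of "-1"] in auto)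
  have "real (card {j \<in> T. x j \<noteq> 0}) * (q * (1 - q)) \<le> 2 * real (card (S \<sigma>)) * (q * (1 - q))"
    using \<sigma>(2) q by (intro mult_right_mono) auto
  then have "sqrt (real (card {j \<in> T. x j \<noteq> 0}) * q * (1 - q) / 4) \<le> sqrt (real (card (S \<sigma>)) * q * (1 - q) / 2)"
    unfolding mult.assoc by (intro real_sqrt_le_mono) linarith
  then show ?thesis
    using one[OF \<sigma>(1)] by (meson measure_nonneg mult_left_mono order_trans)
qed

text \<open>Turning on a single bit of \<open>S\<close> changes the sum over \<open>S\<close>. So if
  the all-False outcome hits the target, every outcome with exactly one True bit misses it;
  otherwise the all-False outcome misses. Both kinds of outcome have probability at least
  \<open>\<gamma>\<close>.\<close>

lemma prob_linear_form_le_of_support: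
  fixes x :: "'a \<Rightarrow> real" and e :: "bool \<Rightarrow> real"
  assumes T: "finite T" and S: "S \<subseteq> T" "\<And>j. j \<in> S \<Longrightarrow> x j \<noteq> 0"
    and e: "e True \<noteq> e False" and q: "q \<in> {0..1}"
    and \<gamma>: "\<gamma> \<le> (1 - q) ^ card S" "\<gamma> \<le> real (card S) * q * (1 - q) ^ (card S - 1)"
  shows "measure_pmf.prob (bernoulli_family T q) {X. (\<Sum>j\<in>T. e (X j) * x j) = a} \<le> 1 - \<gamma>"
proof (rule prob_sum_eq_le_subset[OF T S(1)])
  fix a
  have fin: "finite S" using S T finite_subset by blast
  let ?P = "measure_pmf.prob (bernoulli_family S q)"
  let ?c = "\<lambda>X. card {j \<in> S. X j}"
  obtain k where k: "k \<in> {0, 1}" "\<And>X. ?c X = k \<Longrightarrow> (\<Sum>j\<in>S. e (X j) * x j) \<noteq> a"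
  proof (cases "(\<Sum>j\<in>S. e False * x j) = a")
    case True
    have "(\<Sum>j\<in>S. e (X j) * x j) \<noteq> a" if "?c X = 1" for X
    proof -
      obtain i where i: "{j \<in> S. X j} = {i}" using \<open>?c X = 1\<close> card_1_singletonE by blast
      have "(\<Sum>j\<in>S. e (X j) * x j) =
          (\<Sum>j\<in>S. e False * x j + (if j = i then (e True - e False) * x i else 0))"
      proof (rule sum.cong[OF refl])
        fix j assume "j \<in> S"
        then have "X j \<longleftrightarrow> j = i" using i by auto
        then show "e (X j) * x j = e False * x j + (if j = i then (e True - e False) * x i else 0)"
          by (cases "j = i") (auto simp: algebra_simps)
      qed
      also have "\<dots> = a + (e True - e False) * x i"
        using fin i True by (auto simp: sum.distrib sum.delta)
      finally have "(\<Sum>j\<in>S. e (X j) * x j) = a + (e True - e False) * x i" .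
      then show ?thesis using e S(2)[of i] i by auto
    qed
    then show ?thesis using that[of 1] by simp
  next
    case False
    have "(\<Sum>j\<in>S. e (X j) * x j) \<noteq> a" if "?c X = 0" for X
    proof -
      have "\<not> X j" if "j \<in> S" for j using \<open>?c X = 0\<close> fin that by auto
      then have "(\<Sum>j\<in>S. e (X j) * x j) = (\<Sum>j\<in>S. e False * x j)" by (intro sum.cong) auto
      then show ?thesis using False by simp
    qed
    then show ?thesis using that[of 0] by simp
  qed
  have "\<gamma> \<le> ?P {X. ?c X = k}"
    using k(1) \<gamma> prob_card_True_eq[OF fin order_refl q, of k] by auto
  moreover have "?P {X. (\<Sum>j\<in>S. e (X j) * x j) = a} + ?P {X. ?c X = k} \<le> 1"
    using k(2) by (subst measure_pmf.finite_measure_Union[symmetric]) auto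
  ultimately show "?P {X. (\<Sum>j\<in>S. e (X j) * x j) = a} \<le> 1 - \<gamma>" by simp
qed

subsection \<open>Rows of a random matrix and kernels\<close>


lemma prob_row_eq:
  assumes "finite T"
  shows "measure_pmf.prob (bernoulli_family ({i} \<times> T) q) {X. Q (\<lambda>j. X (i, j))} =
    measure_pmf.prob (bernoulli_family T q) {R. Q R}"
proof -
  have "bernoulli_family T q = map_pmf (\<lambda>X. X \<circ> Pair i) (bernoulli_family ({i} \<times> T) q)"
    using assms by (intro Pi_pmf_bij_betw) (auto simp: bij_betw_def inj_on_def)
  then show ?thesis by (simp add: vimage_def comp_def)
qed

text \<open>Independence of rows: \<open>dep\<close> confines \<open>Q i\<close> to the columns in
  \<open>T\<close>, and rows are added one at a time, conditioning on the earlier ones.\<close>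

lemma prob_all_rows_le:
  assumes "finite J" "finite T" "\<rho> \<ge> 0"
    and dep: "\<And>i R R'. (\<And>j. j \<in> T \<Longrightarrow> R j = R' j) \<Longrightarrow> Q i R \<longleftrightarrow> Q i R'"
    and "\<And>i. i \<in> J \<Longrightarrow> measure_pmf.prob (bernoulli_family T q) {R. Q i R} \<le> \<rho>"
  shows "measure_pmf.prob (bernoulli_family (J \<times> T) q) {X. \<forall>i\<in>J. Q i (\<lambda>j. X (i, j))} \<le> \<rho> ^ card J"
  using assms(1,5)
proof (induction J rule: finite_induct)
  case empty
  then show ?case by simp
next
  case (insert i J)
  have "measure_pmf.prob (bernoulli_family ((J \<times> T) \<union> ({i} \<times> T)) q) {X. \<forall>k\<in>insert i J. Q k (\<lambda>j. X (k, j))}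
      \<le> measure_pmf.prob (bernoulli_family (J \<times> T) q) {Y. \<forall>k\<in>J. Q k (\<lambda>j. Y (k, j))} * \<rho>"
  proof (rule prob_Pi_pmf_union_le_mult)
    fix Y :: "'a \<times> 'b \<Rightarrow> bool"
    define M where "M Z k = (\<lambda>j. if (k, j) \<in> J \<times> T then Y (k, j) else Z (k, j))" for Z k
    have old: "Q k (M Z k) \<longleftrightarrow> Q k (\<lambda>j. Y (k, j))" if "k \<in> J" for k Z
      using that by (intro dep) (auto simp: M_def)
    have new: "Q i (M Z i) \<longleftrightarrow> Q i (\<lambda>j. Z (i, j))" for Z
      using insert.hyps by (intro dep) (auto simp: M_def)
    have "measure_pmf.prob (bernoulli_family ({i} \<times> T) q) {Z. Q i (\<lambda>j. Z (i, j))} \<le> \<rho>"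
      using prob_row_eq[OF assms(2), of i q "Q i"] insert.prems by simp
    moreover have "{Z. \<forall>k\<in>insert i J. Q k (M Z k)} =
        (if \<forall>k\<in>J. Q k (\<lambda>j. Y (k, j)) then {Z. Q i (\<lambda>j. Z (i, j))} else {})"
      using old new by auto
    ultimately show "measure_pmf.prob (bernoulli_family ({i} \<times> T) q)
        {Z. \<forall>k\<in>insert i J. Q k (\<lambda>j. if (k, j) \<in> J \<times> T then Y (k, j) else Z (k, j))}
        \<le> (if \<forall>k\<in>J. Q k (\<lambda>j. Y (k, j)) then \<rho> else 0)"
      unfolding M_def by auto
  qed (use assms(2,3) insert.hyps in auto)
  also have "\<dots> \<le> \<rho> ^ card J * \<rho>"
    using insert.IH insert.prems \<open>\<rho> \<ge> 0\<close> by (intro mult_right_mono) simp_all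
  also have "(J \<times> T) \<union> ({i} \<times> T) = insert i J \<times> T" by auto
  finally show ?case using insert.hyps by (simp add: mult.commute)
qed

text \<open>Gaussian elimination: each column of \<open>S\<close> contributes at most one pivot
  row.\<close>

lemma kernel_determined_by_few_rows:
  fixes a :: "'i \<Rightarrow> 'j \<Rightarrow> 'k :: field"
  assumes "finite S"
  shows "\<exists>I\<subseteq>J. finite I \<and> card I \<le> card S \<and>
    (\<forall>x. (\<forall>i\<in>I. (\<Sum>j\<in>S. a i j * x j) = 0) \<longrightarrow> (\<forall>i\<in>J. (\<Sum>j\<in>S. a i j * x j) = 0))"
  using assms
proof (induction S arbitrary: a rule: finite_induct)
  case empty
  then show ?case by (intro exI[of _ "{}"]) auto
next
  case (insert c S)
  show ?case
  proof (cases "\<forall>i\<in>J. a i c = 0")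
    case True
    obtain I where I: "I \<subseteq> J" "finite I" "card I \<le> card S"
      "\<And>x. \<forall>i\<in>I. (\<Sum>j\<in>S. a i j * x j) = 0 \<Longrightarrow> \<forall>i\<in>J. (\<Sum>j\<in>S. a i j * x j) = 0"
      using insert.IH[of a] by blast
    then show ?thesis using True insert.hyps
      by (intro exI[of _ I]) (auto simp: subset_iff)
  next
    case False
    then obtain r where r: "r \<in> J" "a r c \<noteq> 0" by blast
    \<comment> \<open>Clears column \<open>c\<close> with the pivot row \<open>r\<close>; on vectors
      orthogonal to row \<open>r\<close> this changes no row product.\<close>
    define b where "b i j = a i j - a i c / a r c * a r j" for i j
    obtain I where I: "I \<subseteq> J" "finite I" "card I \<le> card S"
      "\<And>x. \<forall>i\<in>I. (\<Sum>j\<in>S. b i j * x j) = 0 \<Longrightarrow> \<forall>i\<in>J. (\<Sum>j\<in>S. b i j * x j) = 0"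
      using insert.IH[of b] by blast
    have eq: "(\<Sum>j\<in>S. b i j * x j) = (\<Sum>j\<in>insert c S. a i j * x j)"
      if "(\<Sum>j\<in>insert c S. a r j * x j) = 0" for i x
    proof -
      have "(\<Sum>j\<in>S. b i j * x j) = (\<Sum>j\<in>insert c S. b i j * x j)"
        using insert.hyps r by (simp add: b_def)
      also have "\<dots> = (\<Sum>j\<in>insert c S. a i j * x j - a i c / a r c * (a r j * x j))"
        unfolding b_def left_diff_distrib mult.assoc ..
      also have "\<dots> = (\<Sum>j\<in>insert c S. a i j * x j) - a i c / a r c * (\<Sum>j\<in>insert c S. a r j * x j)"
        unfolding sum_subtractf sum_distrib_left ..
      finally show ?thesis using that by simp
    qed
    have "\<forall>i\<in>J. (\<Sum>j\<in>insert c S. a i j * x j) = 0" if x: "\<forall>i\<in>insert r I. (\<Sum>j\<in>insert c S. a i j * x j) = 0" for x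
    proof -
      have "(\<Sum>j\<in>insert c S. a r j * x j) = 0" using x by blast
      from eq[OF this] show ?thesis using I(4)[of x] x by simp
    qed
    moreover have "card (insert r I) \<le> card (insert c S)"
      using I insert.hyps card_insert_le_m1[of "Suc (card S)" I r] by simp
    moreover have "insert r I \<subseteq> J" "finite (insert r I)" using I(1,2) r(1) by auto
    ultimately show ?thesis by blast
  qed
qed

section \<open>Singularity and kernel vectors\<close>

lemma det_mat_eq_0_iff:
  fixes a :: "nat \<times> nat \<Rightarrow> 'a :: field"
  shows "det (mat n n a) = 0 \<longleftrightarrow>
    (\<exists>x. (\<exists>j<n. x j \<noteq> 0) \<and> (\<forall>i<n. (\<Sum>j<n. a (i, j) * x j) = 0))"
proof -
  have mult: "mat n n a *\<^sub>v vec n x = 0\<^sub>v n \<longleftrightarrow> (\<forall>i<n. (\<Sum>j<n. a (i, j) * x j) = 0)" for x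
    by (auto simp: vec_eq_iff scalar_prod_def atLeast0LessThan)
  have nz: "vec n x \<noteq> 0\<^sub>v n \<longleftrightarrow> (\<exists>j<n. x j \<noteq> 0)" for x :: "nat \<Rightarrow> 'a"
    by (auto simp: vec_eq_iff)
  show ?thesis
  proof
    assume "det (mat n n a) = 0"
    then obtain v where v: "v \<in> carrier_vec n" "v \<noteq> 0\<^sub>v n" "mat n n a *\<^sub>v v = 0\<^sub>v n"
      using det_0_iff_vec_prod_zero[of "mat n n a" n] by auto
    moreover have "v = vec n (\<lambda>j. v $ j)" using v(1) by auto
    ultimately show "\<exists>x. (\<exists>j<n. x j \<noteq> 0) \<and> (\<forall>i<n. (\<Sum>j<n. a (i, j) * x j) = 0)"
      using mult nz by metis
  next
    assume "\<exists>x. (\<exists>j<n. x j \<noteq> 0) \<and> (\<forall>i<n. (\<Sum>j<n. a (i, j) * x j) = 0)"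
    then show "det (mat n n a) = 0"
      using det_0_iff_vec_prod_zero[of "mat n n a" n] mult nz
      by (metis mat_carrier vec_carrier)
  qed
qed

lemma singular_mat_imp_det_eq_0:
  fixes A :: "'a :: field mat"
  assumes "singular_mat A"
  shows "det A = 0"
proof (rule ccontr)
  assume "det A \<noteq> 0"
  have A: "A \<in> carrier_mat (dim_row A) (dim_row A)" and sq: "square_mat A"
    using assms by (auto simp: singular_mat_def)
  then have "A \<in> Units (ring_mat TYPE('a) (dim_row A) ())"
    using \<open>det A \<noteq> 0\<close> by (intro det_non_zero_imp_unit)
  then obtain B where "B \<in> carrier_mat (dim_row A) (dim_row A)"
    "A * B = 1\<^sub>m (dim_row A)" "B * A = 1\<^sub>m (dim_row A)"
    unfolding Units_def ring_mat_def by auto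
  then have "invertible_mat A"
    using sq unfolding invertible_mat_def inverts_mat_def by (metis carrier_matD(1))
  then show False using assms by (simp add: singular_mat_def)
qed

subsection \<open>Kernel vectors of small support\<close>


text \<open>Supplies \<open>\<gamma> = c / 4\<close> for
  \<open>prob_linear_form_le_of_support\<close>. On a large support the all-False outcome is too
  rare, so one passes to a part of size about \<open>c / q\<close>: then \<open>s' * q\<close> lies
  between \<open>c\<close> and \<open>c + q \<le> 3 / 4\<close>, and Bernoulli's inequality gives
  \<open>(1 - q) ^ s' \<ge> 1 / 4\<close>.\<close>

lemma exists_balanced_size:
  fixes q c :: real
  assumes q: "0 < q" "q \<le> 1 / 2" and c: "0 < c" "c \<le> 1 / 4" and s: "c \<le> real s * q"
  shows "\<exists>s'\<le>s. c / 4 \<le> (1 - q) ^ s' \<and> c / 4 \<le> real s' * q * (1 - q) ^ (s' - 1)"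
proof -
  define s' where "s' = nat \<lceil>c / q\<rceil>"
  have lo: "c / q \<le> real s'" unfolding s'_def by (simp add: real_nat_ceiling_ge)
  have hi: "real s' < c / q + 1"
    unfolding s'_def using q c by (simp add: of_nat_nat) linarith
  have lo': "c \<le> real s' * q" using lo q by (simp add: field_simps)
  have hi': "real s' * q \<le> 3 / 4"
  proof -
    have "real s' * q < (c / q + 1) * q" using hi q by (intro mult_strict_right_mono) auto
    also have "\<dots> = c + q" using q by (simp add: field_simps)
    finally show ?thesis using q c by simp
  qed
  have "real s' < real s + 1"
  proof -
    have "c / q \<le> real s" using s q by (simp add: field_simps)
    then show ?thesis using hi by linarith
  qed
  then have "s' \<le> s" by linarith
  moreover have pow: "1 / 4 \<le> (1 - q) ^ s'"
    using Bernoulli_inequality[of "- q" s'] hi' q by simp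
  moreover have "(1 - q) ^ s' \<le> (1 - q) ^ (s' - 1)" using q by (intro power_decreasing) auto
  then have "1 / 4 \<le> (1 - q) ^ (s' - 1)" using pow by linarith
  then have "c * (1 / 4) \<le> real s' * q * (1 - q) ^ (s' - 1)"
    using lo' c q by (intro mult_mono) auto
  ultimately show ?thesis using c by (intro exI[of _ s']) auto
qed

section \<open>Supports, and kernel vectors chosen from few rows\<close>

definition vec_support :: "nat \<Rightarrow> (nat \<Rightarrow> real) \<Rightarrow> nat set" where
  "vec_support n x = {j. j < n \<and> x j \<noteq> 0}"

definition row_prod :: "nat \<Rightarrow> (bool \<Rightarrow> real) \<Rightarrow> (nat \<Rightarrow> bool) \<Rightarrow> (nat \<Rightarrow> real) \<Rightarrow> real" where
  "row_prod n e R x = (\<Sum>j<n. e (R j) * x j)"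

definition kernel_vec :: "nat \<Rightarrow> (bool \<Rightarrow> real) \<Rightarrow> (nat \<times> nat \<Rightarrow> bool) \<Rightarrow> (nat \<Rightarrow> real) \<Rightarrow> bool" where
  "kernel_vec n e X x \<longleftrightarrow> (\<forall>i<n. row_prod n e (\<lambda>j. X (i, j)) x = 0)"

definition sparse_kernel :: "nat \<Rightarrow> (bool \<Rightarrow> real) \<Rightarrow> nat \<Rightarrow> (nat \<times> nat \<Rightarrow> bool) set" where
  "sparse_kernel n e t =
    {X. \<exists>x. kernel_vec n e X x \<and> vec_support n x \<noteq> {} \<and> card (vec_support n x) \<le> t}"

text \<open>This depends on the rows in \<open>I\<close> only, hence is independent of the other rows; it is arbitrary
  if no such vector exists.\<close>

definition few_rows_vec :: "nat \<Rightarrow> (bool \<Rightarrow> real) \<Rightarrow> nat set \<Rightarrow> nat set \<Rightarrow> (nat \<times> nat \<Rightarrow> bool) \<Rightarrow> nat \<Rightarrow> real" where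
  "few_rows_vec n e S I X =
    (SOME y. vec_support n y = S \<and> (\<forall>i\<in>I. row_prod n e (\<lambda>j. X (i, j)) y = 0))"

lemma row_prod_cong:
  "(\<And>j. j < n \<Longrightarrow> R j = R' j) \<Longrightarrow> row_prod n e R x = row_prod n e R' x"
  unfolding row_prod_def by (intro sum.cong) auto

lemma row_prod_supported:
  "row_prod n e R x = (\<Sum>j\<in>vec_support n x. e (R j) * x j)"
  unfolding row_prod_def vec_support_def by (intro sum.mono_neutral_right) auto

lemma vec_support_subset: "vec_support n x \<subseteq> {..<n}"
  and finite_vec_support [simp]: "finite (vec_support n x)"
  by (auto simp: vec_support_def)

text \<open>A row without True bits in \<open>S\<close> forces \<open>e False\<close> times the sum
  of \<open>x\<close> to vanish. Subtracting this from a row whose only True bit in \<open>S\<close>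
  is at \<open>r\<close> leaves \<open>(e True - e False) * x r = 0\<close>, which is
  impossible.\<close>

lemma kernel_vec_small_support_cases:
  assumes e: "e True \<noteq> e False" and x: "kernel_vec n e X x" "S = vec_support n x" "S \<noteq> {}"
  shows "\<exists>k\<in>{0, 1}. \<forall>i<n. card {j \<in> S. X (i, j)} \<noteq> k"
proof (rule ccontr)
  assume contra: "\<not> ?thesis"
  then obtain i where i: "i < n" "card {j \<in> S. X (i, j)} = 0" by blast
  from contra obtain i' where i': "i' < n" "card {j \<in> S. X (i', j)} = 1" by blast
  have fin: "finite S" using x by simp
  have "\<not> X (i, j)" if "j \<in> S" for j using i fin that by auto
  then have "(\<Sum>j\<in>S. e False * x j) = row_prod n e (\<lambda>j. X (i, j)) x"
    unfolding row_prod_supported x(2) by (intro sum.cong) auto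
  then have zero: "(\<Sum>j\<in>S. e False * x j) = 0" using i x by (simp add: kernel_vec_def)
  obtain r where r: "{j \<in> S. X (i', j)} = {r}" using i' card_1_singletonE by blast
  have "row_prod n e (\<lambda>j. X (i', j)) x =
      (\<Sum>j\<in>S. e False * x j + (if j = r then (e True - e False) * x r else 0))"
    unfolding row_prod_supported x(2)[symmetric]
  proof (rule sum.cong[OF refl])
    fix j assume "j \<in> S"
    then have "X (i', j) \<longleftrightarrow> j = r" using r by auto
    then show "e (X (i', j)) * x j = e False * x j + (if j = r then (e True - e False) * x r else 0)"
      by (cases "j = r") (auto simp: algebra_simps)
  qed
  also have "\<dots> = (e True - e False) * x r"
    using fin r zero by (auto simp: sum.distrib sum.delta)
  finally have "(e True - e False) * x r = 0" using i' x by (simp add: kernel_vec_def)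
  moreover have "x r \<noteq> 0" using r x(2) by (auto simp: vec_support_def)
  ultimately show False using e by simp
qed

text \<open>Any kernel vector can be traded for one with the same support that is a function of at
  most \<open>card S\<close> rows: \<open>x\<close> itself shows that the choice in
  \<open>few_rows_vec\<close> succeeds, and orthogonality to the rows in \<open>I\<close> spreads to
  all rows.\<close>

lemma few_rows_vec_kernel:
  assumes x: "kernel_vec n e X x"
  obtains I where "I \<subseteq> {..<n}" "card I \<le> card (vec_support n x)"
    "vec_support n (few_rows_vec n e (vec_support n x) I X) = vec_support n x"
    "kernel_vec n e X (few_rows_vec n e (vec_support n x) I X)"
proof -
  define S where "S = vec_support n x"
  obtain I where I: "I \<subseteq> {..<n}" "card I \<le> card S"
    "\<And>y. \<forall>i\<in>I. (\<Sum>j\<in>S. e (X (i, j)) * y j) = 0 \<Longrightarrow> \<forall>i\<in>{..<n}. (\<Sum>j\<in>S. e (X (i, j)) * y j) = 0"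
    using kernel_determined_by_few_rows[of S "{..<n}" "\<lambda>i j. e (X (i, j))"] unfolding S_def by auto
  define y where "y = few_rows_vec n e S I X"
  have "vec_support n x = S \<and> (\<forall>i\<in>I. row_prod n e (\<lambda>j. X (i, j)) x = 0)"
    using x I(1) by (auto simp: S_def kernel_vec_def)
  then have y: "vec_support n y = S \<and> (\<forall>i\<in>I. row_prod n e (\<lambda>j. X (i, j)) y = 0)"
    unfolding y_def few_rows_vec_def by (rule someI[where P = "\<lambda>y. vec_support n y = S \<and> (\<forall>i\<in>I. row_prod n e (\<lambda>j. X (i, j)) y = 0)"])
  have rp: "row_prod n e R y = (\<Sum>j\<in>S. e (R j) * y j)" for R
    unfolding row_prod_supported using y by simp
  have "\<forall>i\<in>I. (\<Sum>j\<in>S. e (X (i, j)) * y j) = 0"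
    using y unfolding rp by blast
  from I(3)[OF this] have "kernel_vec n e X y"
    unfolding kernel_vec_def rp by blast
  then show ?thesis using that I(1,2) y unfolding y_def S_def by blast
qed

text \<open>Conditioning on the rows in \<open>I\<close> fixes the vector. At least
  \<open>n - t\<close> independent rows remain, each orthogonal to it with probability at most
  \<open>1 - c / 4\<close>.\<close>

lemma prob_few_rows_vec_kernel_le:
  assumes e: "e True \<noteq> e False" and q: "0 < q" "q \<le> 1 / 2" and c: "0 < c" "c \<le> 1 / 4"
    and S: "S \<subseteq> {..<n}" "c \<le> real (card S) * q" and I: "I \<subseteq> {..<n}" "card I \<le> t"
  shows "measure_pmf.prob (bernoulli_family ({..<n} \<times> {..<n}) q)
    {X. vec_support n (few_rows_vec n e S I X) = S \<and> kernel_vec n e X (few_rows_vec n e S I X)}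
    \<le> (1 - c / 4) ^ (n - t)"
proof -
  let ?y = "few_rows_vec n e S I"
  let ?N = "{..<n}"
  let ?J = "?N - I"
  have fin: "finite I" using I finite_subset by blast
  have "measure_pmf.prob (bernoulli_family ((I \<times> ?N) \<union> (?J \<times> ?N)) q)
      {X. vec_support n (?y X) = S \<and> kernel_vec n e X (?y X)} \<le> (1 - c / 4) ^ (n - t)"
  proof (rule prob_Pi_pmf_union_le)
    fix Y :: "nat \<times> nat \<Rightarrow> bool"
    define M where "M Z = (\<lambda>ij. if ij \<in> I \<times> ?N then Y ij else Z ij)" for Z
    define y where "y = ?y Y"
    have yM: "?y (M Z) = y" for Z
    proof -
      have "row_prod n e (\<lambda>j. M Z (i, j)) z = row_prod n e (\<lambda>j. Y (i, j)) z" if "i \<in> I" for i z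
        using that by (intro row_prod_cong) (simp add: M_def)
      then show ?thesis unfolding y_def few_rows_vec_def by simp
    qed
    show "measure_pmf.prob (bernoulli_family (?J \<times> ?N) q)
        {Z. vec_support n (?y (M Z)) = S \<and> kernel_vec n e (M Z) (?y (M Z))} \<le> (1 - c / 4) ^ (n - t)"
    proof (cases "vec_support n y = S")
      case True
      obtain s' where s': "s' \<le> card S" "c / 4 \<le> (1 - q) ^ s'" "c / 4 \<le> real s' * q * (1 - q) ^ (s' - 1)"
        using exists_balanced_size[OF q c S(2)] by blast
      obtain S' where S': "S' \<subseteq> S" "card S' = s'"
        using obtain_subset_with_card_n[OF s'(1)] by blast
      have row: "measure_pmf.prob (bernoulli_family ?N q) {R. row_prod n e R y = 0} \<le> 1 - c / 4"
        unfolding row_prod_def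
      proof (rule prob_linear_form_le_of_support[where S = S'])
        show "S' \<subseteq> ?N" using S S' by blast
        show "y j \<noteq> 0" if "j \<in> S'" for j using that S' True by (auto simp: vec_support_def)
      qed (use e q s' S' in auto)
      have "{Z. vec_support n (?y (M Z)) = S \<and> kernel_vec n e (M Z) (?y (M Z))}
          \<subseteq> {Z. \<forall>i\<in>?J. row_prod n e (\<lambda>j. Z (i, j)) y = 0}"
      proof safe
        fix Z i assume "kernel_vec n e (M Z) (?y (M Z))" and i: "i < n" "i \<notin> I"
        then have "row_prod n e (\<lambda>j. M Z (i, j)) y = 0" by (simp add: kernel_vec_def yM)
        then show "row_prod n e (\<lambda>j. Z (i, j)) y = 0" using i by (simp add: M_def)
      qed
      then have "measure_pmf.prob (bernoulli_family (?J \<times> ?N) q)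
          {Z. vec_support n (?y (M Z)) = S \<and> kernel_vec n e (M Z) (?y (M Z))}
          \<le> measure_pmf.prob (bernoulli_family (?J \<times> ?N) q) {Z. \<forall>i\<in>?J. row_prod n e (\<lambda>j. Z (i, j)) y = 0}"
        by (intro measure_pmf.finite_measure_mono) auto
      also have "\<dots> \<le> (1 - c / 4) ^ card ?J"
      proof (rule prob_all_rows_le)
        show "row_prod n e R y = 0 \<longleftrightarrow> row_prod n e R' y = 0" if "\<And>j. j \<in> ?N \<Longrightarrow> R j = R' j" for R R' :: "nat \<Rightarrow> bool"
          using row_prod_cong[of n R R' e y] that by simp
      qed (use row c in auto)
      also have "\<dots> \<le> (1 - c / 4) ^ (n - t)"
        using I fin c by (intro power_decreasing) (auto simp: card_Diff_subset)
      finally show ?thesis .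
    qed (use c in \<open>simp add: yM\<close>)
  qed (use fin in auto)
  moreover have "(I \<times> ?N) \<union> (?J \<times> ?N) = ?N \<times> ?N" using I by auto
  ultimately show ?thesis by simp
qed


section \<open>Union bound over small supports\<close>

lemma sum_power_card_Pow:
  fixes y :: "'b :: comm_semiring_1"
  assumes "finite T"
  shows "(\<Sum>S\<in>Pow T. y ^ card S) = (1 + y) ^ card T"
  using prod_add[OF assms, of "\<lambda>_. y" "\<lambda>_. 1"] by (simp add: add.commute)

text \<open>Since \<open>card S * q < c\<close>, Bernoulli's inequality bounds the relevant powers
  of \<open>1 - q\<close> below by \<open>1 - c\<close>. So a row has exactly one True bit in
  \<open>S\<close> with probability at least \<open>card S * q * (1 - c)\<close>, and none with
  probability at least \<open>1 - c\<close>. The first bound is written as a power with exponent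
  \<open>card S\<close> so that the sum over \<open>S\<close> is a binomial expansion.\<close>

lemma prob_no_row_card_le:
  assumes q: "0 < q" "q \<le> 1 / 2" and c: "0 < c" "c \<le> 1 / 4"
    and S: "S \<subseteq> {..<n}" "S \<noteq> {}" "real (card S) * q < c"
  shows "measure_pmf.prob (bernoulli_family ({..<n} \<times> {..<n}) q)
      {X. \<forall>i<n. card {j \<in> S. X (i, j)} \<noteq> 1} \<le> exp (- (real n * q * (1 - c))) ^ card S"
    and "measure_pmf.prob (bernoulli_family ({..<n} \<times> {..<n}) q)
      {X. \<forall>i<n. card {j \<in> S. X (i, j)} \<noteq> 0} \<le> c ^ n"
proof -
  let ?N = "{..<n}"
  define s where "s = card S"
  have fin: "finite S" using S finite_subset by blast
  then have "s > 0" using S by (simp add: s_def card_gt_0_iff)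
  have bern: "(1 - q) ^ k \<ge> 1 - c" if "k \<le> s" for k
  proof -
    have "1 - c \<le> 1 + real s * (- q)" using S by (simp add: s_def)
    also have "\<dots> \<le> (1 - q) ^ s" using Bernoulli_inequality[of "- q" s] q by simp
    also have "\<dots> \<le> (1 - q) ^ k" using that q by (intro power_decreasing) auto
    finally show ?thesis .
  qed
  have rows: "measure_pmf.prob (bernoulli_family (?N \<times> ?N) q) {X. \<forall>i<n. card {j \<in> S. X (i, j)} \<noteq> k} \<le> \<rho> ^ n"
    if k: "measure_pmf.prob (bernoulli_family ?N q) {R. card {j \<in> S. R j} = k} \<ge> 1 - \<rho>" and "\<rho> \<ge> 0" for k \<rho>
  proof -
    have "measure_pmf.prob (bernoulli_family (?N \<times> ?N) q) {X. \<forall>i\<in>?N. card {j \<in> S. X (i, j)} \<noteq> k} \<le> \<rho> ^ card ?N"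
    proof (rule prob_all_rows_le)
      fix R R' :: "nat \<Rightarrow> bool" assume "\<And>j. j \<in> ?N \<Longrightarrow> R j = R' j"
      then have "{j \<in> S. R j} = {j \<in> S. R' j}" using S by auto
      then show "card {j \<in> S. R j} \<noteq> k \<longleftrightarrow> card {j \<in> S. R' j} \<noteq> k" by simp
    next
      have "measure_pmf.prob (bernoulli_family ?N q) {R. card {j \<in> S. R j} \<noteq> k} =
          1 - measure_pmf.prob (bernoulli_family ?N q) {R. card {j \<in> S. R j} = k}"
        using measure_pmf.prob_compl[of "{R. card {j \<in> S. R j} = k}" "bernoulli_family ?N q"]
        by (simp add: Compl_eq_Diff_UNIV[symmetric] Collect_neg_eq)
      then show "measure_pmf.prob (bernoulli_family ?N q) {R. card {j \<in> S. R j} \<noteq> k} \<le> \<rho>" for i :: nat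
        using k by simp
    qed (use \<open>\<rho> \<ge> 0\<close> in auto)
    then show ?thesis by (simp add: Ball_def)
  qed
  have card_prob: "measure_pmf.prob (bernoulli_family ?N q) {R. card {j \<in> S. R j} = k} =
      real (s choose k) * q ^ k * (1 - q) ^ (s - k)" for k
    unfolding s_def using S q by (intro prob_card_True_eq) auto
  define \<rho> where "\<rho> = exp (- (real s * q * (1 - c)))"
  have "real s * q * (1 - c) \<le> real s * q * (1 - q) ^ (s - 1)"
    using bern[of "s - 1"] q by (intro mult_left_mono) auto
  moreover have "1 - real s * q * (1 - c) \<le> \<rho>"
    using exp_ge_add_one_self[of "- (real s * q * (1 - c))"] by (simp add: \<rho>_def)
  ultimately have "measure_pmf.prob (bernoulli_family (?N \<times> ?N) q) {X. \<forall>i<n. card {j \<in> S. X (i, j)} \<noteq> 1} \<le> \<rho> ^ n"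
    by (intro rows) (simp_all add: card_prob \<rho>_def)
  also have "\<rho> ^ n = exp (- (real n * q * (1 - c))) ^ s"
    unfolding \<rho>_def exp_of_nat_mult[symmetric] by (simp add: mult_ac)
  finally show "measure_pmf.prob (bernoulli_family (?N \<times> ?N) q) {X. \<forall>i<n. card {j \<in> S. X (i, j)} \<noteq> 1}
      \<le> exp (- (real n * q * (1 - c))) ^ card S" unfolding s_def .
  show "measure_pmf.prob (bernoulli_family (?N \<times> ?N) q) {X. \<forall>i<n. card {j \<in> S. X (i, j)} \<noteq> 0} \<le> c ^ n"
    using bern[of s] c by (intro rows) (simp_all add: card_prob)
qed

text \<open>The three summands cover supports \<open>S\<close> with \<open>card S * q < c\<close>
  for which no row has exactly one True bit in \<open>S\<close>, such supports for which no row has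
  zero True bits in \<open>S\<close>, and the larger supports. In the last case pairs
  \<open>(S, I)\<close> of sets of size at most \<open>t\<close> are counted, whence the
  square.\<close>

lemma prob_sparse_kernel_le:
  assumes e: "e True \<noteq> e False" and q: "0 < q" "q \<le> 1 / 2" and c: "0 < c" "c \<le> 1 / 4"
  shows "measure_pmf.prob (bernoulli_family ({..<n} \<times> {..<n}) q) (sparse_kernel n e t)
    \<le> ((1 + exp (- (real n * q * (1 - c)))) ^ n - 1) + (2 * c) ^ n
      + (real (card {S. S \<subseteq> {..<n} \<and> card S \<le> t}))\<^sup>2 * (1 - c / 4) ^ (n - t)"
proof -
  let ?P = "measure_pmf.prob (bernoulli_family ({..<n} \<times> {..<n}) q)"
  define B where "B k S = {X. \<forall>i<n. card {j \<in> S. X (i, j)} \<noteq> k}" for k :: nat and S :: "nat set"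
  define M where "M = (\<lambda>(S, I). {X. vec_support n (few_rows_vec n e S I X) = S \<and> kernel_vec n e X (few_rows_vec n e S I X)})"
  define F where "F = {S. S \<subseteq> {..<n} \<and> S \<noteq> {} \<and> real (card S) * q < c}"
  define G where "G = {S. S \<subseteq> {..<n} \<and> card S \<le> t}"
  define G' where "G' = {S \<in> G. c \<le> real (card S) * q}"
  define y where "y = exp (- (real n * q * (1 - c)))"
  have finF: "finite F" and finG: "finite G"
    by (auto simp: F_def G_def intro: finite_subset[of _ "Pow {..<n}"])
  then have finG': "finite G'" by (simp add: G'_def)
  have "sparse_kernel n e t \<subseteq> (\<Union>S\<in>F. B 1 S) \<union> (\<Union>S\<in>F. B 0 S) \<union> (\<Union>SI\<in>G' \<times> G. M SI)"
  proof
    fix X assume "X \<in> sparse_kernel n e t"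
    then obtain x where x: "kernel_vec n e X x" "vec_support n x \<noteq> {}" "card (vec_support n x) \<le> t"
      by (auto simp: sparse_kernel_def)
    define S where "S = vec_support n x"
    show "X \<in> (\<Union>S\<in>F. B 1 S) \<union> (\<Union>S\<in>F. B 0 S) \<union> (\<Union>SI\<in>G' \<times> G. M SI)"
    proof (cases "real (card S) * q < c")
      case True
      then have "S \<in> F" using x vec_support_subset by (auto simp: F_def S_def)
      moreover obtain k where "k \<in> {0, 1}" "X \<in> B k S"
        using kernel_vec_small_support_cases[OF e x(1) S_def] x(2) unfolding S_def B_def by blast
      ultimately show ?thesis by auto
    next
      case False
      obtain I where I: "I \<subseteq> {..<n}" "card I \<le> card S"
        "vec_support n (few_rows_vec n e S I X) = S" "kernel_vec n e X (few_rows_vec n e S I X)"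
        using few_rows_vec_kernel[OF x(1)] unfolding S_def by blast
      then have "X \<in> M (S, I)" by (simp add: M_def)
      moreover have "S \<in> G'" using False x vec_support_subset by (auto simp: G'_def G_def S_def)
      moreover have "I \<in> G" using I(1,2) x(3) by (simp add: G_def S_def)
      ultimately have "(S, I) \<in> G' \<times> G" "X \<in> M (S, I)" by blast+
      then show ?thesis by blast
    qed
  qed
  then have "?P (sparse_kernel n e t) \<le> ?P ((\<Union>S\<in>F. B 1 S) \<union> (\<Union>S\<in>F. B 0 S) \<union> (\<Union>SI\<in>G' \<times> G. M SI))"
    by (intro measure_pmf.finite_measure_mono) auto
  also have "\<dots> \<le> ?P (\<Union>S\<in>F. B 1 S) + ?P (\<Union>S\<in>F. B 0 S) + ?P (\<Union>SI\<in>G' \<times> G. M SI)"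
    by (intro order_trans[OF measure_Un_le] add_right_mono measure_Un_le) auto
  also have "\<dots> \<le> (\<Sum>S\<in>F. ?P (B 1 S)) + (\<Sum>S\<in>F. ?P (B 0 S)) + (\<Sum>SI\<in>G' \<times> G. ?P (M SI))"
    using finF finG finG' by (intro add_mono measure_pmf.finite_measure_subadditive_finite) auto
  also have "\<dots> \<le> ((1 + y) ^ n - 1) + (2 * c) ^ n + (real (card G))\<^sup>2 * (1 - c / 4) ^ (n - t)"
  proof (intro add_mono)
    have "(\<Sum>S\<in>F. ?P (B 1 S)) \<le> (\<Sum>S\<in>F. y ^ card S)"
      unfolding B_def y_def by (intro sum_mono prob_no_row_card_le(1)[OF q c]) (auto simp: F_def)
    \<comment> \<open>Leaving out the empty set produces the \<open>- 1\<close> that makes this term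
      tend to 0.\<close>
    also have "\<dots> \<le> (\<Sum>S\<in>Pow {..<n} - {{}}. y ^ card S)"
      by (intro sum_mono2) (auto simp: F_def y_def)
    also have "\<dots> = (1 + y) ^ n - 1"
      using sum_power_card_Pow[of "{..<n}" y] by (simp add: sum_diff1)
    finally show "(\<Sum>S\<in>F. ?P (B 1 S)) \<le> (1 + y) ^ n - 1" .
  next
    have "(\<Sum>S\<in>F. ?P (B 0 S)) \<le> (\<Sum>S\<in>F. c ^ n)"
      unfolding B_def by (intro sum_mono prob_no_row_card_le(2)[OF q c]) (auto simp: F_def)
    also have "\<dots> \<le> (\<Sum>S\<in>Pow {..<n}. c ^ n)"
      using c by (intro sum_mono2) (auto simp: F_def)
    also have "\<dots> = (2 * c) ^ n" by (simp add: card_Pow power_mult_distrib)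
    finally show "(\<Sum>S\<in>F. ?P (B 0 S)) \<le> (2 * c) ^ n" .
  next
    have "(\<Sum>SI\<in>G' \<times> G. ?P (M SI)) \<le> (\<Sum>SI\<in>G' \<times> G. (1 - c / 4) ^ (n - t))"
    proof (rule sum_mono)
      fix SI assume "SI \<in> G' \<times> G"
      then show "?P (M SI) \<le> (1 - c / 4) ^ (n - t)"
        unfolding M_def by (auto simp: G'_def G_def intro!: prob_few_rows_vec_kernel_le[OF e q c])
    qed
    also have "\<dots> = real (card G') * real (card G) * (1 - c / 4) ^ (n - t)"
      by (simp add: card_cartesian_product)
    also have "\<dots> \<le> (real (card G))\<^sup>2 * (1 - c / 4) ^ (n - t)"
      using finG c unfolding power2_eq_square
      by (intro mult_right_mono) (auto simp: G'_def intro: card_mono)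
    finally show "(\<Sum>SI\<in>G' \<times> G. ?P (M SI)) \<le> (real (card G))\<^sup>2 * (1 - c / 4) ^ (n - t)" .
  qed
  finally show ?thesis unfolding y_def G_def .
qed

subsection \<open>Kernel vectors of large support\<close>


text \<open>Composing with \<open>prod.swap\<close> transposes the matrix; this invariance carries
  the sparse kernel bound over to left kernel vectors.\<close>

lemma prob_swap_eq:
  "measure_pmf.prob (bernoulli_family ({..<n} \<times> {..<n}) q) {X. X \<circ> prod.swap \<in> A} =
   measure_pmf.prob (bernoulli_family ({..<n} \<times> {..<n}) q) A" for n :: nat
proof -
  have "bernoulli_family ({..<n} \<times> {..<n}) q =
      map_pmf (\<lambda>X. X \<circ> prod.swap) (bernoulli_family ({..<n} \<times> {..<n}) q)"
    by (intro Pi_pmf_bij_betw) (auto simp: bij_betw_def inj_on_def)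
  then have "measure_pmf.prob (bernoulli_family ({..<n} \<times> {..<n}) q) A =
      measure_pmf.prob (map_pmf (\<lambda>X. X \<circ> prod.swap) (bernoulli_family ({..<n} \<times> {..<n}) q)) A"
    by (rule arg_cong)
  then show ?thesis by (simp add: vimage_def)
qed

text \<open>A function of the rows other than \<open>i\<close>, hence independent of row
  \<open>i\<close>.\<close>

definition other_rows_vec :: "nat \<Rightarrow> (bool \<Rightarrow> real) \<Rightarrow> nat \<Rightarrow> (nat \<times> nat \<Rightarrow> bool) \<Rightarrow> nat \<Rightarrow> real" where
  "other_rows_vec n e i X =
    (SOME z. vec_support n z \<noteq> {} \<and> (\<forall>k<n. k \<noteq> i \<longrightarrow> row_prod n e (\<lambda>j. X (k, j)) z = 0))"

lemma prob_row_orthogonal_le: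
  assumes e: "e True \<noteq> e False" and q: "0 < q" "q < 1" and "i < n" "0 < t"
  shows "measure_pmf.prob (bernoulli_family ({..<n} \<times> {..<n}) q)
    {X. t \<le> card (vec_support n (other_rows_vec n e i X)) \<and>
        row_prod n e (\<lambda>j. X (i, j)) (other_rows_vec n e i X) = 0} \<le> 2 / sqrt (real t * q * (1 - q) / 4)"
proof -
  let ?N = "{..<n}" and ?z = "other_rows_vec n e i"
  let ?A = "(?N - {i}) \<times> ?N"
  define r where "r = sqrt (real t * q * (1 - q) / 4)"
  have r: "r > 0" using q \<open>0 < t\<close> by (simp add: r_def)
  have "measure_pmf.prob (bernoulli_family (?A \<union> ({i} \<times> ?N)) q)
      {X. t \<le> card (vec_support n (?z X)) \<and> row_prod n e (\<lambda>j. X (i, j)) (?z X) = 0} \<le> 2 / r"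
  proof (rule prob_Pi_pmf_union_le)
    fix Y :: "nat \<times> nat \<Rightarrow> bool"
    define M where "M Z = (\<lambda>ij. if ij \<in> ?A then Y ij else Z ij)" for Z
    define z where "z = ?z Y"
    have zM: "?z (M Z) = z" for Z
    proof -
      have "row_prod n e (\<lambda>j. M Z (k, j)) x = row_prod n e (\<lambda>j. Y (k, j)) x" if "k < n" "k \<noteq> i" for k x
        using that by (intro row_prod_cong) (simp add: M_def)
      then show ?thesis unfolding z_def other_rows_vec_def by (simp cong: conj_cong imp_cong)
    qed
    have row: "row_prod n e (\<lambda>j. M Z (i, j)) z = row_prod n e (\<lambda>j. Z (i, j)) z" for Z
      by (intro row_prod_cong) (simp add: M_def)
    show "measure_pmf.prob (bernoulli_family ({i} \<times> ?N) q)
      {Z. t \<le> card (vec_support n (?z (M Z))) \<and> row_prod n e (\<lambda>j. M Z (i, j)) (?z (M Z)) = 0} \<le> 2 / r"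
    proof (cases "t \<le> card (vec_support n z)")
      case True
      define r' where "r' = sqrt (real (card {j \<in> ?N. z j \<noteq> 0}) * q * (1 - q) / 4)"
      have "r \<le> r'"
        unfolding r_def r'_def using True q
        by (intro real_sqrt_le_mono divide_right_mono mult_right_mono) (auto simp: vec_support_def)
      have "measure_pmf.prob (bernoulli_family ?N q) {R. row_prod n e R z = 0} * r
          \<le> measure_pmf.prob (bernoulli_family ?N q) {R. row_prod n e R z = 0} * r'"
        using \<open>r \<le> r'\<close> by (intro mult_left_mono) auto
      also have "\<dots> \<le> 2"
        unfolding r'_def row_prod_def using e q by (intro prob_linear_form_le) auto
      finally have "measure_pmf.prob (bernoulli_family ?N q) {R. row_prod n e R z = 0} \<le> 2 / r"
        using r by (simp add: pos_le_divide_eq)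
      then have "measure_pmf.prob (bernoulli_family ({i} \<times> ?N) q) {Z. row_prod n e (\<lambda>j. Z (i, j)) z = 0} \<le> 2 / r"
        using prob_row_eq[of ?N i q "\<lambda>R. row_prod n e R z = 0"] by simp
      then show ?thesis using True by (simp add: zM row)
    qed (use r in \<open>simp add: zM\<close>)
  qed auto
  moreover have "?A \<union> ({i} \<times> ?N) = ?N \<times> ?N" using \<open>i < n\<close> by auto
  ultimately show ?thesis unfolding r_def by simp
qed

text \<open>The vector \<open>x\<close> shows that the choice succeeds. In the double sum of
  \<open>y k * X (k, j) * z j\<close>, with entries read through \<open>e\<close>, summing over
  \<open>k\<close> first gives 0, while summing over \<open>j\<close> first leaves only
  \<open>y i\<close> times the product of row \<open>i\<close> with \<open>z\<close>; as
  \<open>y i\<close> is nonzero, row \<open>i\<close> is orthogonal to \<open>z\<close> too.\<close>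

lemma other_rows_vec_kernel:
  assumes x: "vec_support n x \<noteq> {}" "kernel_vec n e X x"
    and y: "kernel_vec n e (X \<circ> prod.swap) y" and i: "i \<in> vec_support n y"
  shows "vec_support n (other_rows_vec n e i X) \<noteq> {}" and "kernel_vec n e X (other_rows_vec n e i X)"
proof -
  define z where "z = other_rows_vec n e i X"
  have "vec_support n x \<noteq> {} \<and> (\<forall>k<n. k \<noteq> i \<longrightarrow> row_prod n e (\<lambda>j. X (k, j)) x = 0)"
    using x by (auto simp: kernel_vec_def)
  then have z: "vec_support n z \<noteq> {} \<and> (\<forall>k<n. k \<noteq> i \<longrightarrow> row_prod n e (\<lambda>j. X (k, j)) z = 0)"
    unfolding z_def other_rows_vec_def
    by (rule someI[where P = "\<lambda>z. vec_support n z \<noteq> {} \<and> (\<forall>k<n. k \<noteq> i \<longrightarrow> row_prod n e (\<lambda>j. X (k, j)) z = 0)"])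
  have i': "i < n" "y i \<noteq> 0" using i by (auto simp: vec_support_def)
  have "(\<Sum>k<n. y k * row_prod n e (\<lambda>j. X (k, j)) z) = (\<Sum>j<n. row_prod n e (\<lambda>k. X (k, j)) y * z j)"
    unfolding row_prod_def sum_distrib_left sum_distrib_right
    by (subst sum.swap) (simp add: mult_ac)
  also have "\<dots> = 0"
    using y by (intro sum.neutral) (auto simp: kernel_vec_def)
  finally have "(\<Sum>k<n. y k * row_prod n e (\<lambda>j. X (k, j)) z) = 0" .
  moreover have "(\<Sum>k<n. y k * row_prod n e (\<lambda>j. X (k, j)) z) = y i * row_prod n e (\<lambda>j. X (i, j)) z"
    using z i' by (subst sum.remove[of _ i]) (auto intro!: sum.neutral)
  ultimately have "row_prod n e (\<lambda>j. X (i, j)) z = 0" using i' by simp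
  then have "row_prod n e (\<lambda>j. X (k, j)) z = 0" if "k < n" for k using z that by (cases "k = i") auto
  then show "kernel_vec n e X z" by (simp add: kernel_vec_def)
  show "vec_support n z \<noteq> {}" using z by blast
qed

text \<open>Double counting: on \<open>E\<close> the support of a left kernel vector has at least
  \<open>t\<close> elements, and \<open>D i\<close> occurs for each of them. Taking expectations
  gives \<open>t * P(E) \<le> n * \<beta>\<close>. The factor 2 accounts for sparse left and right
  kernel vectors.\<close>

lemma prob_kernel_le:
  assumes e: "e True \<noteq> e False" and q: "0 < q" "q < 1" and t: "0 < t"
  shows "measure_pmf.prob (bernoulli_family ({..<n} \<times> {..<n}) q)
      {X. (\<exists>x. vec_support n x \<noteq> {} \<and> kernel_vec n e X x) \<and>
          (\<exists>y. vec_support n y \<noteq> {} \<and> kernel_vec n e (X \<circ> prod.swap) y)}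
    \<le> 2 * measure_pmf.prob (bernoulli_family ({..<n} \<times> {..<n}) q) (sparse_kernel n e t)
      + real n / real t * (2 / sqrt (real t * q * (1 - q) / 4))"
proof -
  let ?B = "bernoulli_family ({..<n} \<times> {..<n}) q"
  let ?P = "measure_pmf.prob ?B"
  define \<beta> where "\<beta> = 2 / sqrt (real t * q * (1 - q) / 4)"
  let ?sw = "{X. X \<circ> prod.swap \<in> sparse_kernel n e t}"
  define K where "K = {X. (\<exists>x. vec_support n x \<noteq> {} \<and> kernel_vec n e X x) \<and>
          (\<exists>y. vec_support n y \<noteq> {} \<and> kernel_vec n e (X \<circ> prod.swap) y)}"
  define E where "E = K - (sparse_kernel n e t \<union> ?sw)"
  define D where "D i = {X. t \<le> card (vec_support n (other_rows_vec n e i X)) \<and>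
        row_prod n e (\<lambda>j. X (i, j)) (other_rows_vec n e i X) = 0}" for i
  have many: "real t * indicator E X \<le> (\<Sum>i<n. indicator (D i) X)" for X
  proof (cases "X \<in> E")
    case True
    then obtain x y where x: "vec_support n x \<noteq> {}" "kernel_vec n e X x"
      and y: "vec_support n y \<noteq> {}" "kernel_vec n e (X \<circ> prod.swap) y"
      and ns: "X \<notin> sparse_kernel n e t" "X \<circ> prod.swap \<notin> sparse_kernel n e t"
      by (auto simp: E_def K_def)
    have "X \<in> D i" if i: "i \<in> vec_support n y" for i
    proof -
      note z = other_rows_vec_kernel[OF x y(2) i]
      then have "t \<le> card (vec_support n (other_rows_vec n e i X))"
        using ns(1) unfolding sparse_kernel_def mem_Collect_eq by (meson linear)
      moreover have "i < n" using i by (simp add: vec_support_def)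
      ultimately show ?thesis using z(2) by (simp add: D_def kernel_vec_def)
    qed
    then have "(\<Sum>i\<in>vec_support n y. 1) \<le> (\<Sum>i\<in>vec_support n y. indicator (D i) X :: real)"
      by (intro sum_mono) auto
    also have "\<dots> \<le> (\<Sum>i<n. indicator (D i) X)"
      by (intro sum_mono2 vec_support_subset) auto
    finally have "real (card (vec_support n y)) \<le> (\<Sum>i<n. indicator (D i) X)" by simp
    moreover have "t \<le> card (vec_support n y)"
      using ns(2) y unfolding sparse_kernel_def mem_Collect_eq by (meson linear)
    ultimately show ?thesis using True by simp
  qed (simp add: sum_nonneg)
  have int: "integrable (measure_pmf ?B) f" for f :: "_ \<Rightarrow> real"
    by (intro integrable_measure_pmf_finite finite_subset[OF set_Pi_pmf_subset']) (auto intro: finite_PiE_dflt)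
  have "real t * ?P E = measure_pmf.expectation ?B (\<lambda>X. real t * indicator E X)" by simp
  also have "\<dots> \<le> measure_pmf.expectation ?B (\<lambda>X. \<Sum>i<n. indicator (D i) X)"
    by (intro integral_mono int many)
  also have "\<dots> = (\<Sum>i<n. ?P (D i))" by (subst Bochner_Integration.integral_sum) (auto intro: int)
  also have "\<dots> \<le> (\<Sum>i<n. \<beta>)"
    unfolding D_def \<beta>_def using prob_row_orthogonal_le[OF e q _ t] by (intro sum_mono) auto
  finally have "real t * ?P E \<le> real n * \<beta>" by simp
  then have PE: "?P E \<le> real n / real t * \<beta>" using t by (simp add: field_simps)
  have "?P K \<le> ?P (sparse_kernel n e t \<union> ?sw \<union> E)"
    by (intro measure_pmf.finite_measure_mono) (auto simp: E_def)
  also have "\<dots> \<le> ?P (sparse_kernel n e t) + ?P ?sw + ?P E"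
    by (intro order_trans[OF measure_Un_le] add_right_mono measure_Un_le) auto
  finally show ?thesis using PE prob_swap_eq[of n q "sparse_kernel n e t"] unfolding K_def \<beta>_def by simp
qed

subsection \<open>Asymptotics\<close>


text \<open>Exponential weighting: with weight \<open>l ^ card S\<close>, \<open>l < 1\<close>, the
  small sets number at most \<open>(1 + l) ^ n / l ^ t \<le> exp (l * n + t * L)\<close>. Choosing
  \<open>l\<close>, then \<open>\<delta>\<close>, makes each summand in the exponent at most
  \<open>\<eta> * n / 2\<close>.\<close>

lemma card_small_subsets_le:
  fixes \<eta> :: real
  assumes "\<eta> > 0"
  shows "\<exists>\<delta>>0. \<delta> \<le> 1 / 2 \<and>
    (\<forall>n t. real t \<le> \<delta> * real n \<longrightarrow> real (card {S. S \<subseteq> {..<n} \<and> card S \<le> t}) \<le> exp (\<eta> * real n))"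
proof -
  define l where "l = min (\<eta> / 2) (1 / 2)"
  define L where "L = ln (1 / l)"
  define \<delta> where "\<delta> = min (1 / 2) (\<eta> / (2 * L))"
  have l: "0 < l" "l < 1" "l \<le> \<eta> / 2" using assms by (auto simp: l_def)
  have L: "L > 0" using l by (simp add: L_def)
  have \<delta>: "0 < \<delta>" "\<delta> \<le> 1 / 2" "\<delta> * L \<le> \<eta> / 2"
    using assms L by (auto simp: \<delta>_def min_def field_simps)
  have "real (card {S. S \<subseteq> {..<n} \<and> card S \<le> t}) \<le> exp (\<eta> * real n)"
    if t: "real t \<le> \<delta> * real n" for n t
  proof -
    let ?G = "{S. S \<subseteq> {..<n} \<and> card S \<le> t}"
    have "real (card ?G) * l ^ t = (\<Sum>S\<in>?G. l ^ t)" by simp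
    also have "\<dots> \<le> (\<Sum>S\<in>?G. l ^ card S)"
      using l by (intro sum_mono power_decreasing) auto
    also have "\<dots> \<le> (\<Sum>S\<in>Pow {..<n}. l ^ card S)"
      using l by (intro sum_mono2) auto
    also have "\<dots> = (1 + l) ^ n" by (simp add: sum_power_card_Pow)
    also have "\<dots> \<le> exp l ^ n" using l by (intro power_mono exp_ge_add_one_self) auto
    also have "\<dots> = exp (real n * l)" by (simp add: exp_of_nat_mult)
    finally have "real (card ?G) * l ^ t * exp (real t * L) \<le> exp (real n * l) * exp (real t * L)"
      by (intro mult_right_mono) auto
    moreover have "l ^ t * exp (real t * L) = 1"
      using l by (simp add: exp_of_nat_mult L_def power_one_over)
    ultimately have "real (card ?G) \<le> exp (real n * l + real t * L)"
      by (simp add: exp_add mult.assoc)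
    also have "\<dots> \<le> exp (\<eta> * real n)"
    proof -
      have "real n * l \<le> real n * (\<eta> / 2)" using l by (intro mult_left_mono) auto
      moreover have "real t * L \<le> \<delta> * real n * L" using t L by (intro mult_right_mono) auto
      moreover have "\<delta> * L * real n \<le> \<eta> / 2 * real n" using \<delta> by (intro mult_right_mono) auto
      ultimately have "real n * l + real t * L \<le> \<eta> * real n" by (simp add: algebra_simps)
      then show ?thesis by simp
    qed
    finally show ?thesis .
  qed
  then show ?thesis using \<delta> by blast
qed

lemma singular_mat_imp_kernel_vecs:
  assumes "singular_mat (mat n n (\<lambda>ij. e (X ij)))"
  shows "(\<exists>x. vec_support n x \<noteq> {} \<and> kernel_vec n e X x) \<and>
    (\<exists>y. vec_support n y \<noteq> {} \<and> kernel_vec n e (X \<circ> prod.swap) y)"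
proof -
  have det: "det (mat n n (\<lambda>ij. e (X ij))) = 0"
    using assms by (rule singular_mat_imp_det_eq_0)
  have "mat n n (\<lambda>ij. e ((X \<circ> prod.swap) ij)) = transpose_mat (mat n n (\<lambda>ij. e (X ij)))"
    by (intro eq_matI) auto
  then have "det (mat n n (\<lambda>ij. e ((X \<circ> prod.swap) ij))) = 0"
    using det by (simp add: det_transpose[of _ n])
  moreover have "det (mat n n (\<lambda>ij. e (Y ij))) = 0 \<longleftrightarrow> (\<exists>x. vec_support n x \<noteq> {} \<and> kernel_vec n e Y x)" for Y
    unfolding det_mat_eq_0_iff vec_support_def kernel_vec_def row_prod_def by simp
  ultimately show ?thesis using det by blast
qed

lemma bernoulli_mat_pmf_complement:
  assumes "p \<in> {0..1}"
  shows "bernoulli_mat_pmf n p =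
    map_pmf (\<lambda>X. mat n n (\<lambda>ij. of_bool (\<not> X ij))) (bernoulli_family ({..<n} \<times> {..<n}) (1 - p))"
proof -
  let ?N = "{..<n} \<times> {..<n}"
  have "bernoulli_pmf p = map_pmf Not (bernoulli_pmf (1 - p))"
  proof (rule pmf_eqI)
    fix b
    have "pmf (map_pmf Not (bernoulli_pmf (1 - p))) (Not (\<not> b)) = pmf (bernoulli_pmf (1 - p)) (\<not> b)"
      by (rule pmf_map_inj') (auto simp: inj_def)
    then show "pmf (bernoulli_pmf p) b = pmf (map_pmf Not (bernoulli_pmf (1 - p))) b"
      using assms by (cases b) auto
  qed
  \<comment> \<open>Negation turns the default True into False. The default is then swapped back,
    which is invisible to the matrix.\<close>
  then have "bernoulli_family ?N p = map_pmf (\<lambda>X. Not \<circ> X) (Pi_pmf ?N True (\<lambda>_. bernoulli_pmf (1 - p)))"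
    by (simp add: Pi_pmf_map)
  also have "Pi_pmf ?N True (\<lambda>_. bernoulli_pmf (1 - p)) =
      map_pmf (\<lambda>X ij. if ij \<in> ?N then X ij else True) (bernoulli_family ?N (1 - p))"
    by (simp add: Pi_pmf_default_swap)
  finally show ?thesis
    unfolding bernoulli_mat_pmf_def
    by (auto simp: pmf.map_comp intro!: map_pmf_cong eq_matI)
qed

lemma prob_singular_le:
  assumes "p \<in> {0..1}" "q = min p (1 - p)" "0 < q" "c > 0" "c \<le> 1 / 4" "0 < t"
  shows "measure_pmf.prob (bernoulli_mat_pmf n p) {M. singular_mat M} \<le>
    2 * (((1 + exp (- (real n * q * (1 - c)))) ^ n - 1) + (2 * c) ^ n
      + (real (card {S. S \<subseteq> {..<n} \<and> card S \<le> t}))\<^sup>2 * (1 - c / 4) ^ (n - t))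
      + real n / real t * (2 / sqrt (real t * q * (1 - q) / 4))"
    (is "_ \<le> 2 * ?A + ?B")
proof -
  \<comment> \<open>For \<open>p > 1 / 2\<close> the bits are negated, so that their parameter is
    always \<open>q \<le> 1 / 2\<close>.\<close>
  obtain e :: "bool \<Rightarrow> real" where e: "e True \<noteq> e False" and law: "bernoulli_mat_pmf n p =
      map_pmf (\<lambda>X. mat n n (\<lambda>ij. e (X ij))) (bernoulli_family ({..<n} \<times> {..<n}) q)"
  proof (cases "p \<le> 1 / 2")
    case True
    then show ?thesis
      using assms by (intro that[of of_bool]) (auto simp: bernoulli_mat_pmf_def min_def)
  next
    case False
    then have "q = 1 - p" using assms by simp
    then show ?thesis
      using bernoulli_mat_pmf_complement[OF assms(1)] by (intro that[of "\<lambda>b. of_bool (\<not> b)"]) auto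
  qed
  let ?P = "measure_pmf.prob (bernoulli_family ({..<n} \<times> {..<n}) q)"
  have q: "0 < q" "q \<le> 1 / 2" "q < 1" using assms(2,3) by (auto simp: min_def split: if_splits)
  have "measure_pmf.prob (bernoulli_mat_pmf n p) {M. singular_mat M} =
      ?P {X. singular_mat (mat n n (\<lambda>ij. e (X ij)))}"
    unfolding law by (simp add: vimage_def)
  also have "\<dots> \<le> ?P {X. (\<exists>x. vec_support n x \<noteq> {} \<and> kernel_vec n e X x) \<and>
          (\<exists>y. vec_support n y \<noteq> {} \<and> kernel_vec n e (X \<circ> prod.swap) y)}"
    using singular_mat_imp_kernel_vecs[of n e] by (intro measure_pmf.finite_measure_mono) auto
  also have "\<dots> \<le> 2 * ?P (sparse_kernel n e t) + ?B"
    using e q assms by (intro prob_kernel_le) auto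
  also have "\<dots> \<le> 2 * ?A + ?B"
    using prob_sparse_kernel_le[OF e q(1,2) assms(4,5)] by (intro add_right_mono mult_left_mono) auto
  finally show ?thesis .
qed

lemma prob_singular_le_explicit:
  fixes a c \<delta> :: real
  assumes a: "0 < a" "a \<le> 1" and c: "c = a / 4" and \<delta>: "0 < \<delta>" "\<delta> \<le> 1 / 2"
    and few: "\<And>t. real t \<le> \<delta> * real n \<Longrightarrow>
      real (card {S. S \<subseteq> {..<n} \<and> card S \<le> t}) \<le> exp (c / 32 * real n)"
    and p: "p \<in> {0..1}" "(1 + a) * (ln (real n) / real n) \<le> min p (1 - p)"
    and n: "2 < n" "2 / \<delta> \<le> real n"
  shows "measure_pmf.prob (bernoulli_mat_pmf n p) {M. singular_mat M} \<le>
    2 * ((exp (real n powr - (a / 2)) - 1) + (1 / 2) ^ n + exp (- (c / 16) * real n))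
      + 4 / \<delta> / sqrt (\<delta> * ln (real n) / 16)"
proof -
  define q where "q = min p (1 - p)"
  define t where "t = nat \<lfloor>\<delta> * real n\<rfloor>"
  have c': "0 < c" "c \<le> 1 / 4" using a c by auto
  have ln: "ln (real n) > 0" using n by simp
  have q2: "q \<le> 1 / 2" by (auto simp: q_def min_def)
  have nq: "real n * q \<ge> (1 + a) * ln (real n)"
    using p(2) n by (simp add: q_def[symmetric] field_simps)
  then have nq': "real n * q \<ge> ln (real n)"
    using a ln by (smt (verit) mult_le_cancel_right1)
  then have q0: "q > 0" using ln n by (smt (verit) mult_nonneg_nonpos of_nat_0_le_iff)
  have t_le: "real t \<le> \<delta> * real n" unfolding t_def using \<delta> by simp
  have t_ge: "real t \<ge> \<delta> * real n / 2"
  proof -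
    have "\<delta> * real n \<ge> 2" using n \<delta> by (simp add: field_simps)
    moreover have "real t \<ge> \<delta> * real n - 1" unfolding t_def using \<delta> by linarith
    ultimately show ?thesis by linarith
  qed
  have t0: "0 < t" using t_ge \<delta> n by (smt (verit) divide_pos_pos mult_pos_pos of_nat_0_less_iff of_nat_less_0_iff)
  have t_half: "real t \<le> real n / 2"
    using t_le mult_right_mono[OF \<delta>(2), of "real n"] by simp
  have A: "(1 + exp (- (real n * q * (1 - c)))) ^ n \<le> exp (real n powr - (a / 2))"
  proof -
    define y where "y = exp (- (real n * q * (1 - c)))"
    \<comment> \<open>Here the constant above 1 is spent:
      \<open>(1 + a) * (1 - a / 4) \<ge> 1 + a / 2\<close> because \<open>a \<le> 1\<close>, so
      \<open>n * y\<close> is at most \<open>n powr - (a / 2)\<close>.\<close>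
    have "(1 + a / 2) * ln (real n) \<le> (1 + a) * (1 - c) * ln (real n)"
      using a c ln by (intro mult_right_mono) (auto simp: algebra_simps power2_eq_square[symmetric] intro: mult_left_le)
    also have "\<dots> \<le> real n * q * (1 - c)"
      using mult_right_mono[OF nq, of "1 - c"] c' by (simp add: mult_ac)
    finally have "y \<le> exp (- ((1 + a / 2) * ln (real n)))" unfolding y_def by simp
    also have "\<dots> = real n powr - (1 + a / 2)" using n by (simp add: powr_def algebra_simps)
    finally have "real n * y \<le> real n * real n powr - (1 + a / 2)" using n by (intro mult_left_mono) auto
    also have "\<dots> = real n powr (1 + - (1 + a / 2))" using n by (subst powr_add) simp
    finally have ny: "real n * y \<le> real n powr - (a / 2)" by simp
    have "(1 + y) ^ n \<le> exp y ^ n"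
      by (intro power_mono exp_ge_add_one_self) (auto simp: y_def)
    also have "\<dots> = exp (real n * y)" by (simp add: exp_of_nat_mult)
    also have "\<dots> \<le> exp (real n powr - (a / 2))" using ny by simp
    finally show ?thesis unfolding y_def .
  qed
  have B: "(2 * c) ^ n \<le> (1 / 2) ^ n" using c' by (intro power_mono) auto
  \<comment> \<open>The two choices of a set cost \<open>exp (c / 16 * n)\<close> together; the at
    least \<open>n / 2\<close> remaining rows gain \<open>exp (- (c / 8) * n)\<close>.\<close>
  have C: "(real (card {S. S \<subseteq> {..<n} \<and> card S \<le> t}))\<^sup>2 * (1 - c / 4) ^ (n - t) \<le> exp (- (c / 16) * real n)"
  proof -
    have "(real (card {S. S \<subseteq> {..<n} \<and> card S \<le> t}))\<^sup>2 \<le> (exp (c / 32 * real n))\<^sup>2"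
      using few[OF t_le] by (intro power_mono) auto
    also have "\<dots> = exp (c / 16 * real n)" by (simp add: exp_double[symmetric])
    finally have "(real (card {S. S \<subseteq> {..<n} \<and> card S \<le> t}))\<^sup>2 \<le> exp (c / 16 * real n)" .
    moreover have "(1 - c / 4) ^ (n - t) \<le> exp (- (c / 8) * real n)"
    proof -
      have "(1 - c / 4) ^ (n - t) \<le> exp (- (c / 4)) ^ (n - t)"
        using exp_ge_add_one_self[of "- (c / 4)"] c' by (intro power_mono) auto
      also have "\<dots> = exp (- (c / 4) * real (n - t))" by (simp add: exp_of_nat_mult[symmetric] mult.commute)
      also have "\<dots> \<le> exp (- (c / 4) * (real n / 2))"
        using t_half c' by (intro exp_le_cancel_iff[THEN iffD2] mult_left_mono_neg) (auto simp: of_nat_diff)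
      finally show ?thesis by simp
    qed
    ultimately have "(real (card {S. S \<subseteq> {..<n} \<and> card S \<le> t}))\<^sup>2 * (1 - c / 4) ^ (n - t)
        \<le> exp (c / 16 * real n) * exp (- (c / 8) * real n)"
      using c' by (intro mult_mono) auto
    also have "\<dots> = exp (- (c / 16) * real n)" unfolding exp_add[symmetric] by (simp add: algebra_simps)
    finally show ?thesis .
  qed
  \<comment> \<open>Combines \<open>t \<ge> \<delta> * n / 2\<close>,
    \<open>n * q \<ge> ln n\<close> and \<open>1 - q \<ge> 1 / 2\<close>.\<close>
  have D: "real n / real t * (2 / sqrt (real t * q * (1 - q) / 4)) \<le> 4 / \<delta> / sqrt (\<delta> * ln (real n) / 16)"
  proof -
    have "real n / real t \<le> 2 / \<delta>" using t_ge t0 \<delta> by (simp add: field_simps)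
    moreover have "2 / sqrt (real t * q * (1 - q) / 4) \<le> 2 / sqrt (\<delta> * ln (real n) / 16)"
    proof (intro divide_left_mono real_sqrt_le_mono)
      have "\<delta> * ln (real n) / 2 \<le> \<delta> * (real n * q) / 2" using nq' \<delta> by simp
      also have "\<dots> = \<delta> * real n / 2 * q" by simp
      also have "\<dots> \<le> real t * q" using t_ge q0 by (intro mult_right_mono) auto
      finally have "\<delta> * ln (real n) / 2 * (1 / 2) \<le> real t * q * (1 - q)"
        using q0 q2 \<delta> ln by (intro mult_mono) auto
      then show "\<delta> * ln (real n) / 16 \<le> real t * q * (1 - q) / 4" by simp
    qed (use \<delta> ln t0 q0 q2 in auto)
    ultimately have "real n / real t * (2 / sqrt (real t * q * (1 - q) / 4)) \<le>
        2 / \<delta> * (2 / sqrt (\<delta> * ln (real n) / 16))"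
      using \<delta> ln q0 q2 by (intro mult_mono) auto
    then show ?thesis by simp
  qed
  have "measure_pmf.prob (bernoulli_mat_pmf n p) {M. singular_mat M} \<le>
    2 * (((1 + exp (- (real n * q * (1 - c)))) ^ n - 1) + (2 * c) ^ n
      + (real (card {S. S \<subseteq> {..<n} \<and> card S \<le> t}))\<^sup>2 * (1 - c / 4) ^ (n - t))
      + real n / real t * (2 / sqrt (real t * q * (1 - q) / 4))"
    by (rule prob_singular_le[OF p(1) q_def q0 c' t0])
  also have "\<dots> \<le> 2 * ((exp (real n powr - (a / 2)) - 1) + (1 / 2) ^ n + exp (- (c / 16) * real n))
      + 4 / \<delta> / sqrt (\<delta> * ln (real n) / 16)"
    by (intro add_mono mult_left_mono diff_mono A B C D order_refl) simp
  finally show ?thesis .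
qed

theorem theorem1p1:
  fixes \<epsilon> :: real and p :: "nat \<Rightarrow> real"
  assumes "\<epsilon> > 0"
    and "\<And>n. p n \<in> {0..1}"
    and "\<forall>\<^sub>F n in sequentially. min (p n) (1 - p n) \<ge> (1 + \<epsilon>) * (ln (real n) / real n)"
  shows "(\<lambda>n. measure_pmf.prob (bernoulli_mat_pmf n (p n)) {M. singular_mat M}) \<longlonglongrightarrow> 0"
proof -
  \<comment> \<open>Capping \<open>\<epsilon>\<close> at 1 only weakens the lower bound on
    \<open>p\<close>, and it ensures \<open>c \<le> 1 / 4\<close>.\<close>
  define a where "a = min \<epsilon> 1"
  define c where "c = a / 4"
  have a: "0 < a" "a \<le> 1" "a \<le> \<epsilon>" using assms(1) by (auto simp: a_def)
  then have c: "c > 0" by (simp add: c_def)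
  obtain \<delta> where \<delta>: "0 < \<delta>" "\<delta> \<le> 1 / 2" and few: "\<And>n t. real t \<le> \<delta> * real n \<Longrightarrow>
      real (card {S. S \<subseteq> {..<n} \<and> card S \<le> t}) \<le> exp (c / 32 * real n)"
    using card_small_subsets_le[of "c / 32"] c by auto
  define g where "g n = 2 * ((exp (real n powr - (a / 2)) - 1) + (1 / 2) ^ n + exp (- (c / 16) * real n))
      + 4 / \<delta> / sqrt (\<delta> * ln (real n) / 16)" for n :: nat
  have le: "\<forall>\<^sub>F n in sequentially. measure_pmf.prob (bernoulli_mat_pmf n (p n)) {M. singular_mat M} \<le> g n"
    using assms(3) eventually_gt_at_top[of 2] eventually_ge_at_top[of "nat \<lceil>2 / \<delta>\<rceil>"]
  proof eventually_elim
    case (elim n)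
    have "(1 + a) * (ln (real n) / real n) \<le> (1 + \<epsilon>) * (ln (real n) / real n)"
      using a elim by (intro mult_right_mono) auto
    then have "(1 + a) * (ln (real n) / real n) \<le> min (p n) (1 - p n)" using elim by linarith
    moreover have "2 / \<delta> \<le> real n" using elim by linarith
    ultimately show ?case
      unfolding g_def using a \<delta> few assms(2) elim by (intro prob_singular_le_explicit c_def)
  qed
  have lim: "g \<longlonglongrightarrow> 0"
  proof -
    have t1: "(\<lambda>n. exp (real n powr - (a / 2)) - 1) \<longlonglongrightarrow> 0" using a(1) by real_asymp
    have t2: "(\<lambda>n. (1 / 2) ^ n :: real) \<longlonglongrightarrow> 0" by real_asymp
    have t3: "(\<lambda>n. exp (- (c / 16) * real n)) \<longlonglongrightarrow> 0" using c by real_asymp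
    have t4: "(\<lambda>n. 4 / \<delta> / sqrt (\<delta> * ln (real n) / 16)) \<longlonglongrightarrow> 0" using \<delta>(1) by real_asymp
    show ?thesis
      using tendsto_add[OF tendsto_mult[OF tendsto_const[of 2] tendsto_add[OF tendsto_add[OF t1 t2] t3]] t4]
      unfolding g_def by simp
  qed
  show ?thesis
    by (rule tendsto_sandwich[OF _ le tendsto_const lim]) simp
qed

end
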